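(* Let $j\ge1$, let $q$ be a solution of the $(2j-1)$-th $\mathcal{G}_{m,n}$-flow with frame $F$ normalized by $F(0,0,\lambda)=I$. Let $\alpha_1,\alpha_2\in\mathbb{C}\setminus\{0\}$ with $|\alpha_1|\ne|\alpha_2|$ and $\pi_1,\pi_2$ be $O(m+n+1,m+n)$-projections. Let $\tilde\pi_i(x,t)$ be the $O(m+n+1,m+n)$-projection onto $F(x,t,\alpha_i)^{-1}(\mathrm{Im}\,\pi_i)$ ($i=1,2$; nondegeneracy assumed), $\tilde\phi=(\alpha_1-\alpha_2)I+2\alpha_2\tilde\pi_2-2\alpha_1\tilde\pi_1$ (assumed invertible), and $\tilde\tau_i=\tilde\phi\tilde\pi_i\tilde\phi^{-1}$. Set $q_i=q+2\alpha_i[e_{2m+1,2m+2n+1},\tilde\pi_i]$, $i=1,2$. Then $$q_1+2\alpha_2[e_{2m+1,2m+2n+1},\tilde\tau_2]=q_2+2\alpha_1[e_{2m+1,2m+2n+1},\tilde\tau_1]=:q_{12},$$ and $q_1,q_2,q_{12}$ are solutions of the $(2j-1)$-th $\mathcal{G}_{m,n}$-flow; $q_{12}$ is obtained from $q_2$ by the Darboux transformation with data $(\alpha_1,\tau_1)$ and from $q_1$ with data $(\alpha_2,\tau_2)$, where $\tau_i=\phi\pi_i\phi^{-1}$, $\phi=(\alpha_1-\alpha_2)I+2\alpha_2\pi_2-2\alpha_1\pi_1$.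
   Context: Setup: $N=2m+2n+1$; $C_{m,n}=\mathrm{diag}(\sum_{i=1}^{2m}e_{i,2m+1-i},\sum_{i=1}^{2n+1}(-1)^{n+i-1}e_{i,2n+2-i})$; $\sigma(Y)=(C_{m,n}Y^tC_{m,n}^{-1})^{-1}$, $\sigma_*(y)=-C_{m,n}y^tC_{m,n}^{-1}$; $\mathcal{G}_{m,n}$: formal series $\sum_{i\le i_0}\xi_i\lambda^i$ in $sl(N,\mathbb{C})$ with $\sigma_*(\xi(-\lambda))=\xi(\lambda)$; $(G_{m,n})_-$: series $I+\sum_{i<0}g_i\lambda^i$ with $\sigma(g(-\lambda))=g(\lambda)$; $(\cdot)_+$ nonnegative-power part; $b=\sum_{i=1}^{2n}e_{i+1,i}$, $J_0=\lambda e_{1,2n+1}+b$, $J=\mathrm{diag}(0_{2m},J_0)$; $Y_{m,n}=\{([J,g])_+:g\in(\mathcal{G}_{m,n})_-\}$; $S(q,\lambda)$ unique series with $S_x+[J+q,S]=0$, $S=gJg^{-1}$ ($g$ in $(G_{m,n})_-$), $S^k=\sum_iS_{k,i}\lambda^i$. Flow: $q_t=S_{2j-1,0}(q)_x+[\mathrm{diag}(0,b)+q,S_{2j-1,0}(q)]$. Frame: $F\in SL(N)$ with $F^{-1}F_x=J+q$, $F^{-1}F_t=(S^{2j-1}(q,\lambda))_+$, $\sigma(F(x,t,-\lambda))=F(x,t,\lambda)$. Form $\langle X,Y\rangle=X^tC_{m,n}Y$, adjoint $\sharp$; $O(m+n+1,m+n)$-projection: $\pi^2=\pi=\pi^\sharp$.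 Darboux transformation with data $(\alpha,\pi)$ applied to $q$ with frame $F$: $q\mapsto q+2\alpha[e_{2m+1,N},\tilde\pi]$, $\tilde\pi$ the projection onto $F(x,t,\alpha)^{-1}(\mathrm{Im}\,\pi)$, new frame $k_{\alpha,\pi}Fk_{\alpha,\tilde\pi}^{-1}$, $k_{\alpha,\pi}=I+\frac{2\alpha}{\lambda-\alpha}(I-\pi)$. *)

theory Defs
  imports "HOL-Analysis.Analysis" "HOL-Library.Function_Algebras"
begin

text \<open>Matrices are represented as functions nat => nat => complex (0-based indices);
  an N x N matrix is one vanishing outside the index box below N.
  Operations take the size N explicitly. Addition / subtraction / 0 are pointwise
  (Function_Algebras); matrix product is mmul.\<close>

type_synonym cmat = "nat \<Rightarrow> nat \<Rightarrow> complex"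
type_synonym cvec = "nat \<Rightarrow> complex"
type_synonym cser = "int \<Rightarrow> cmat"  \<comment> \<open>formal series in lambda: k-th coefficient\<close>

definition Nd :: "nat \<Rightarrow> nat \<Rightarrow> nat" where "Nd m n = 2*m + 2*n + 1"

definition wfm :: "nat \<Rightarrow> cmat \<Rightarrow> bool" where
  "wfm N A \<longleftrightarrow> (\<forall>i k. (N \<le> i \<or> N \<le> k) \<longrightarrow> A i k = 0)"

definition mmul :: "nat \<Rightarrow> cmat \<Rightarrow> cmat \<Rightarrow> cmat" where
  "mmul N A B = (\<lambda>i k. if i < N \<and> k < N then (\<Sum>l<N. A i l * B l k) else 0)"

definition idm :: "nat \<Rightarrow> cmat" where
  "idm N = (\<lambda>i k. if i < N \<and> k < N \<and> i = k then 1 else 0)"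

definition smul :: "complex \<Rightarrow> cmat \<Rightarrow> cmat" where
  "smul c A = (\<lambda>i k. c * A i k)"

text \<open>Elementary matrix e_{a,b} with the paper's 1-based indices.\<close>
definition Em :: "nat \<Rightarrow> nat \<Rightarrow> cmat" where
  "Em a b = (\<lambda>i k. if i = a - 1 \<and> k = b - 1 then 1 else 0)"

definition mtr :: "cmat \<Rightarrow> cmat" where "mtr A = (\<lambda>i k. A k i)"

definition mtrace :: "nat \<Rightarrow> cmat \<Rightarrow> complex" where "mtrace N A = (\<Sum>i<N. A i i)"

definition mdet :: "nat \<Rightarrow> cmat \<Rightarrow> complex" where
  "mdet N A = (\<Sum>p | p permutes {..<N}. of_int (sign p) * (\<Prod>i<N. A i (p i)))"

definition invertible_m :: "nat \<Rightarrow> cmat \<Rightarrow> bool" where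
  "invertible_m N A \<longleftrightarrow> wfm N A \<and> (\<exists>B. wfm N B \<and> mmul N A B = idm N \<and> mmul N B A = idm N)"

definition minv :: "nat \<Rightarrow> cmat \<Rightarrow> cmat" where
  "minv N A = (SOME B. wfm N B \<and> mmul N A B = idm N \<and> mmul N B A = idm N)"

definition brk :: "nat \<Rightarrow> cmat \<Rightarrow> cmat \<Rightarrow> cmat" where
  "brk N A B = mmul N A B - mmul N B A"

definition Cmn :: "nat \<Rightarrow> nat \<Rightarrow> cmat" where
  "Cmn m n = (\<Sum>i\<in>{1..2*m}. Em i (2*m + 1 - i))
     + (\<Sum>i\<in>{1..2*n+1}. smul ((-1) ^ (n + i - 1)) (Em (2*m + i) (2*m + 2*n + 2 - i)))"

definition sigma :: "nat \<Rightarrow> nat \<Rightarrow> cmat \<Rightarrow> cmat" where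
  "sigma m n Y = minv (Nd m n) (mmul (Nd m n) (mmul (Nd m n) (Cmn m n) (mtr Y)) (minv (Nd m n) (Cmn m n)))"

definition sigma_star :: "nat \<Rightarrow> nat \<Rightarrow> cmat \<Rightarrow> cmat" where
  "sigma_star m n y = - mmul (Nd m n) (mmul (Nd m n) (Cmn m n) (mtr y)) (minv (Nd m n) (Cmn m n))"

text \<open>Adjoint w.r.t. <X,Y> = X^t C Y:  A^# = C^{-1} A^t C\<close>
definition adj :: "nat \<Rightarrow> nat \<Rightarrow> cmat \<Rightarrow> cmat" where
  "adj m n A = mmul (Nd m n) (mmul (Nd m n) (minv (Nd m n) (Cmn m n)) (mtr A)) (Cmn m n)"

definition Oproj :: "nat \<Rightarrow> nat \<Rightarrow> cmat \<Rightarrow> bool" where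
  "Oproj m n p \<longleftrightarrow> wfm (Nd m n) p \<and> mmul (Nd m n) p p = p \<and> adj m n p = p"

definition vecs :: "nat \<Rightarrow> cvec set" where "vecs N = {v. \<forall>i\<ge>N. v i = 0}"

definition mvec :: "nat \<Rightarrow> cmat \<Rightarrow> cvec \<Rightarrow> cvec" where
  "mvec N A v = (\<lambda>i. if i < N then (\<Sum>l<N. A i l * v l) else 0)"

definition mimage :: "nat \<Rightarrow> cmat \<Rightarrow> cvec set" where "mimage N A = mvec N A ` vecs N"

definition Oproj_onto :: "nat \<Rightarrow> nat \<Rightarrow> cmat \<Rightarrow> cvec set \<Rightarrow> bool" where
  "Oproj_onto m n p V \<longleftrightarrow> Oproj m n p \<and> mimage (Nd m n) p = V"

definition bmat :: "nat \<Rightarrow> nat \<Rightarrow> cmat" where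
  "bmat m n = (\<Sum>i\<in>{1..2*n}. Em (2*m + i + 1) (2*m + i))"

definition emat :: "nat \<Rightarrow> nat \<Rightarrow> cmat" where "emat m n = Em (2*m + 1) (Nd m n)"

definition Jser :: "nat \<Rightarrow> nat \<Rightarrow> cser" where
  "Jser m n = (\<lambda>k. if k = 0 then bmat m n else if k = 1 then emat m n else 0)"

definition Jeval :: "nat \<Rightarrow> nat \<Rightarrow> complex \<Rightarrow> cmat" where
  "Jeval m n z = bmat m n + smul z (emat m n)"

definition sbounded :: "cser \<Rightarrow> bool" where "sbounded A \<longleftrightarrow> (\<exists>d. \<forall>i>d. A i = 0)"

definition sbound :: "cser \<Rightarrow> int" where "sbound A = (SOME d. \<forall>i>d. A i = 0)"

definition smult :: "nat \<Rightarrow> cser \<Rightarrow> cser \<Rightarrow> cser" where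
  "smult N A B = (\<lambda>k. \<Sum>i\<in>{k - sbound B .. sbound A}. mmul N (A i) (B (k - i)))"

definition sone :: "nat \<Rightarrow> cser" where "sone N = (\<lambda>k. if k = 0 then idm N else 0)"

primrec spow :: "nat \<Rightarrow> cser \<Rightarrow> nat \<Rightarrow> cser" where
  "spow N A 0 = sone N"
| "spow N A (Suc k) = smult N A (spow N A k)"

definition scomm :: "nat \<Rightarrow> cser \<Rightarrow> cser \<Rightarrow> cser" where
  "scomm N A B = (\<lambda>k. smult N A B k - smult N B A k)"

text \<open>the series xi(-lambda)\<close>
definition sneg :: "cser \<Rightarrow> cser" where "sneg A = (\<lambda>k. if even k then A k else - A k)"

definition pos_eval :: "cser \<Rightarrow> complex \<Rightarrow> cmat" where
  "pos_eval A z = (\<Sum>i\<le>nat (sbound A). smul (z ^ i) (A (int i)))"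

definition lie_minus :: "nat \<Rightarrow> nat \<Rightarrow> cser \<Rightarrow> bool" where
  "lie_minus m n xi \<longleftrightarrow> (\<forall>i\<ge>0. xi i = 0)
     \<and> (\<forall>i. wfm (Nd m n) (xi i) \<and> mtrace (Nd m n) (xi i) = 0)
     \<and> (\<forall>i. sigma_star m n (sneg xi i) = xi i)"

text \<open>(G_{m,n})_- : g = I + sum_{i<0} g_i lambda^i with sigma(g(-lambda)) = g(lambda), i.e.
  g(lambda) * (C g(-lambda)^t C^{-1}) = I as formal series\<close>
definition grp_minus :: "nat \<Rightarrow> nat \<Rightarrow> cser \<Rightarrow> bool" where
  "grp_minus m n g \<longleftrightarrow> g 0 = idm (Nd m n) \<and> (\<forall>i>0. g i = 0) \<and> (\<forall>i. wfm (Nd m n) (g i))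
     \<and> smult (Nd m n) g (\<lambda>k. mmul (Nd m n) (mmul (Nd m n) (Cmn m n) (mtr (sneg g k))) (minv (Nd m n) (Cmn m n)))
        = sone (Nd m n)"

definition Ymem :: "nat \<Rightarrow> nat \<Rightarrow> cmat \<Rightarrow> bool" where
  "Ymem m n q \<longleftrightarrow> (\<exists>xi. lie_minus m n xi \<and>
      (\<forall>i\<ge>0. scomm (Nd m n) (Jser m n) xi i = (if i = 0 then q else 0)))"

definition pdx :: "(real \<Rightarrow> real \<Rightarrow> cmat) \<Rightarrow> real \<Rightarrow> real \<Rightarrow> cmat" where
  "pdx f x t = (\<lambda>i k. vector_derivative (\<lambda>y. f y t i k) (at x))"

definition pdt :: "(real \<Rightarrow> real \<Rightarrow> cmat) \<Rightarrow> real \<Rightarrow> real \<Rightarrow> cmat" where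
  "pdt f x t = (\<lambda>i k. vector_derivative (\<lambda>s. f x s i k) (at t))"

definition diffx :: "(real \<Rightarrow> real \<Rightarrow> cmat) \<Rightarrow> bool" where
  "diffx f \<longleftrightarrow> (\<forall>x t i k. (\<lambda>y. f y t i k) differentiable (at x))"

definition difft :: "(real \<Rightarrow> real \<Rightarrow> cmat) \<Rightarrow> bool" where
  "difft f \<longleftrightarrow> (\<forall>x t i k. (\<lambda>s. f x s i k) differentiable (at t))"

text \<open>S x t is the series S(q(.,t),lambda) at the point x:
  S_x + [J+q,S] = 0 and S = g J g^{-1} (written S g = g J) with g in (G_{m,n})_-\<close>
definition Scond :: "nat \<Rightarrow> nat \<Rightarrow> (real \<Rightarrow> real \<Rightarrow> cmat) \<Rightarrow> (real \<Rightarrow> real \<Rightarrow> cser) \<Rightarrow> bool" where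
  "Scond m n q S \<longleftrightarrow>
     (\<forall>i. diffx (\<lambda>x t. S x t i)) \<and>
     (\<forall>x t. sbounded (S x t) \<and> (\<forall>i. wfm (Nd m n) (S x t i))
        \<and> (\<exists>g. grp_minus m n g \<and> smult (Nd m n) (S x t) g = smult (Nd m n) g (Jser m n))
        \<and> (\<forall>i. pdx (\<lambda>x t. S x t i) x t
               + scomm (Nd m n) (\<lambda>k. Jser m n k + (if k = 0 then q x t else 0)) (S x t) i = 0))"

definition flow_eq :: "nat \<Rightarrow> nat \<Rightarrow> nat \<Rightarrow> (real \<Rightarrow> real \<Rightarrow> cmat) \<Rightarrow> (real \<Rightarrow> real \<Rightarrow> cser) \<Rightarrow> bool" where
  "flow_eq m n j q S \<longleftrightarrow> difft q \<and> diffx (\<lambda>x t. spow (Nd m n) (S x t) (2*j - 1) 0) \<and>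
     (\<forall>x t. pdt q x t = pdx (\<lambda>x t. spow (Nd m n) (S x t) (2*j - 1) 0) x t
        + brk (Nd m n) (bmat m n + q x t) (spow (Nd m n) (S x t) (2*j - 1) 0))"

definition flow_sol :: "nat \<Rightarrow> nat \<Rightarrow> nat \<Rightarrow> (real \<Rightarrow> real \<Rightarrow> cmat) \<Rightarrow> bool" where
  "flow_sol m n j q \<longleftrightarrow> (\<forall>x t. Ymem m n (q x t)) \<and> (\<exists>S. Scond m n q S \<and> flow_eq m n j q S)"

definition frame_sol :: "nat \<Rightarrow> nat \<Rightarrow> nat \<Rightarrow> (real \<Rightarrow> real \<Rightarrow> cmat) \<Rightarrow> (real \<Rightarrow> real \<Rightarrow> complex \<Rightarrow> cmat) \<Rightarrow> bool" where
  "frame_sol m n j q F \<longleftrightarrow> (\<forall>x t. Ymem m n (q x t)) \<and>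
     (\<exists>S. Scond m n q S \<and> flow_eq m n j q S \<and>
        (\<forall>z. diffx (\<lambda>x t. F x t z) \<and> difft (\<lambda>x t. F x t z)) \<and>
        (\<forall>x t z. wfm (Nd m n) (F x t z) \<and> mdet (Nd m n) (F x t z) = 1
           \<and> mmul (Nd m n) (minv (Nd m n) (F x t z)) (pdx (\<lambda>x t. F x t z) x t) = Jeval m n z + q x t
           \<and> mmul (Nd m n) (minv (Nd m n) (F x t z)) (pdt (\<lambda>x t. F x t z) x t)
               = pos_eval (spow (Nd m n) (S x t) (2*j - 1)) z
           \<and> sigma m n (F x t (- z)) = F x t z))"

definition kmat :: "nat \<Rightarrow> nat \<Rightarrow> complex \<Rightarrow> cmat \<Rightarrow> complex \<Rightarrow> cmat" where
  "kmat m n a p z = idm (Nd m n) + smul (2 * a / (z - a)) (idm (Nd m n) - p)"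

definition dt_frame :: "nat \<Rightarrow> nat \<Rightarrow> complex \<Rightarrow> cmat \<Rightarrow> (real \<Rightarrow> real \<Rightarrow> complex \<Rightarrow> cmat)
    \<Rightarrow> (real \<Rightarrow> real \<Rightarrow> cmat) \<Rightarrow> (real \<Rightarrow> real \<Rightarrow> complex \<Rightarrow> cmat)" where
  "dt_frame m n a p F pt = (\<lambda>x t z. mmul (Nd m n) (mmul (Nd m n) (kmat m n a p z) (F x t z))
      (minv (Nd m n) (kmat m n a (pt x t) z)))"

definition darboux :: "nat \<Rightarrow> nat \<Rightarrow> complex \<Rightarrow> cmat \<Rightarrow> (real \<Rightarrow> real \<Rightarrow> cmat)
    \<Rightarrow> (real \<Rightarrow> real \<Rightarrow> complex \<Rightarrow> cmat) \<Rightarrow> (real \<Rightarrow> real \<Rightarrow> cmat) \<Rightarrow> bool" where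
  "darboux m n a p q F q' \<longleftrightarrow> a \<noteq> 0 \<and> Oproj m n p \<and>
     (\<forall>x t. \<exists>pt. Oproj_onto m n pt (mvec (Nd m n) (minv (Nd m n) (F x t a)) ` mimage (Nd m n) p)
        \<and> q' x t = q x t + smul (2 * a) (brk (Nd m n) (emat m n) pt))"

end

theory Submission
  imports "Jordan_Normal_Form.Determinant" Defs
begin

text \<open>Put \<open>T = 2 a P - a\<close>, so that \<open>(z - a) k_{a,P}(z) = z - T\<close>. If \<open>P\<close> projects onto a subspace
  that is parallel for the connection at \<open>z = a\<close> along one that is parallel at \<open>z = - a\<close>, then
  \<open>P\<close> satisfies a Riccati equation, which says exactly that \<open>z - T\<close> divides its gauge transform on
  the right; hence \<open>k S k^{-1}\<close> is the series of the dressed potential. Comparing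
  the coefficients of index \<open>- 1\<close> in \<open>(k S k^{-1})^{2j-1}\<close> shows that the new potential solves the flow,
  because the flow reads \<open>q_t = - [e, (S^{2j-1})_{-1}]\<close>.

  For two factors, \<open>phi = T2 - T1\<close> and \<open>T1^2\<close>, \<open>T2^2\<close> are scalar, so with \<open>s = a2^2 - a1^2\<close> the conjugates
  \<open>Ti' = phi Ti phi^{-1}\<close> are \<open>T1' = s phi^{-1} - T2\<close> and \<open>T2' = s phi^{-1} - T1\<close>. This gives the symmetry
  \<open>T1' + T2 = T2' + T1\<close> and the self-adjointness of \<open>tau1\<close>, \<open>tau2\<close>. On the image of \<open>P1\<close> the matrix \<open>a1 - T2\<close>
  acts as \<open>- phi\<close>, which identifies the image of \<open>tau1\<close> with the one transported by the dressed frame.\<close>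

subsection \<open>Matrix algebra\<close>

text \<open>The second Darboux step shapes the proof. The formula for the dressed frame degenerates
  at \<open>z = a1\<close> and \<open>z = - a1\<close>, where a factor has a pole or fails to be
  invertible, whereas \<open>frame_sol\<close> asks for a frame at every \<open>z\<close>; a step
  from frame to frame could not be iterated without removing these singularities. So the step takes
  any projection obeying the Riccati equations in \<open>x\<close> and \<open>t\<close>. Such
  projections come from matrices parallel at \<open>a\<close> and \<open>- a\<close> alone, and
  distinct moduli keep \<open>a2\<close> and \<open>- a2\<close> away from the bad values of the
  first factor. In the time direction the positive parts satisfy
  \<open>W(z) (z - T) = (z - T) V(z) + K\<close> with \<open>K\<close> free of \<open>z\<close>. At
  \<open>z = a\<close> and \<open>z = - a\<close> the factor \<open>z - T\<close> is a multiple of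
  \<open>1 - P\<close> or of \<open>P\<close>, so these two values determine \<open>K\<close>: it is
  \<open>2 a\<close> times the time derivative that the Riccati equation gives to \<open>P\<close>.
  Hence comparing one coefficient suffices, without an evolution equation for the series in
  \<open>t\<close>. The moving projections are given pointwise by their ranges; that they are
  differentiable is derived, through Cramer's rule.\<close>

lemma mmul_assoc: "mmul N (mmul N A B) C = mmul N A (mmul N B C)"
proof (intro ext)
  fix i k
  show "mmul N (mmul N A B) C i k = mmul N A (mmul N B C) i k"
  proof (cases "i < N \<and> k < N")
    case True
    have "mmul N (mmul N A B) C i k = (\<Sum>l<N. \<Sum>r<N. A i r * B r l * C l k)"
      using True by (simp add: mmul_def sum_distrib_right)
    also have "\<dots> = (\<Sum>r<N. \<Sum>l<N. A i r * B r l * C l k)"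
      by (rule sum.swap)
    also have "\<dots> = mmul N A (mmul N B C) i k"
      using True by (simp add: mmul_def sum_distrib_left mult.assoc)
    finally show ?thesis .
  qed (auto simp: mmul_def)
qed

lemma mmul_add_left: "mmul N (A + B) C = mmul N A C + mmul N B C"
  and mmul_add_right: "mmul N A (B + C) = mmul N A B + mmul N A C"
  and mmul_diff_left: "mmul N (A - B) C = mmul N A C - mmul N B C"
  and mmul_diff_right: "mmul N A (B - C) = mmul N A B - mmul N A C"
  and mmul_minus_left: "mmul N (- A) C = - mmul N A C"
  and mmul_minus_right: "mmul N A (- C) = - mmul N A C"
  and mmul_smul_left: "mmul N (smul c A) B = smul c (mmul N A B)"
  and mmul_smul_right: "mmul N A (smul c B) = smul c (mmul N A B)"
  and mmul_zero_left [simp]: "mmul N 0 A = 0"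
  and mmul_zero_right [simp]: "mmul N A 0 = 0"
  by (auto simp: mmul_def smul_def fun_eq_iff algebra_simps sum.distrib sum_subtractf
      sum_distrib_left sum_negf)

lemma smul_add: "smul c (A + B) = smul c A + smul c B"
  and smul_diff: "smul c (A - B) = smul c A - smul c B"
  and smul_minus: "smul c (- A) = - smul c A"
  and smul_smul: "smul c (smul d A) = smul (c * d) A"
  and smul_zero [simp]: "smul c 0 = 0" "smul 0 A = 0"
  and smul_one [simp]: "smul 1 A = A"
  by (auto simp: smul_def fun_eq_iff algebra_simps)

lemmas mmul_distribs = mmul_add_left mmul_add_right mmul_diff_left mmul_diff_right
  mmul_minus_left mmul_minus_right mmul_smul_left mmul_smul_right
  smul_add smul_diff smul_minus smul_smul mmul_assoc

lemma sum_mat_apply: "sum f I r s = (\<Sum>i\<in>I. f i r s)" for f :: "'i \<Rightarrow> cmat"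
proof (cases "finite I")
  case True
  then show ?thesis by (induction I rule: finite_induct) simp_all
qed simp

lemma mmul_sum_left: "mmul N (\<Sum>i\<in>I. f i) B = (\<Sum>i\<in>I. mmul N (f i) B)"
  and mmul_sum_right: "mmul N B (\<Sum>i\<in>I. f i) = (\<Sum>i\<in>I. mmul N B (f i))"
  by (auto simp: fun_eq_iff mmul_def sum_mat_apply sum_distrib_right sum_distrib_left)
    (rule sum.swap)+

lemma smul_sum: "smul c (\<Sum>i\<in>I. f i) = (\<Sum>i\<in>I. smul c (f i))"
  by (auto simp: fun_eq_iff smul_def sum_mat_apply sum_distrib_left)

lemma wfm_mmul [simp]: "wfm N (mmul N A B)"
  and wfm_idm [simp]: "wfm N (idm N)"
  and wfm_zero [simp]: "wfm N 0"
  and wfm_add [simp]: "wfm N A \<Longrightarrow> wfm N B \<Longrightarrow> wfm N (A + B)"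
  and wfm_diff [simp]: "wfm N A \<Longrightarrow> wfm N B \<Longrightarrow> wfm N (A - B)"
  and wfm_smul [simp]: "wfm N A \<Longrightarrow> wfm N (smul c A)"
  by (auto simp: wfm_def mmul_def idm_def smul_def mtr_def)

lemma wfm_sum [simp]: "(\<And>i. i \<in> I \<Longrightarrow> wfm N (f i)) \<Longrightarrow> wfm N (\<Sum>i\<in>I. f i)"
  by (auto simp: wfm_def sum_mat_apply)

lemma mmul_idm_right [simp]: "wfm N A \<Longrightarrow> mmul N A (idm N) = A"
proof (intro ext)
  fix i k assume A: "wfm N A"
  have "(\<Sum>l<N. A i l * idm N l k) = (\<Sum>l<N. if l = k then A i l else 0)" if "k < N"
    using that by (intro sum.cong) (auto simp: idm_def)
  then show "mmul N A (idm N) i k = A i k"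
    using A by (auto simp: mmul_def wfm_def not_less)
qed

lemma mmul_idm_left [simp]: "wfm N A \<Longrightarrow> mmul N (idm N) A = A"
proof (intro ext)
  fix i k assume A: "wfm N A"
  have "(\<Sum>l<N. idm N i l * A l k) = (\<Sum>l<N. if l = i then A l k else 0)" if "i < N"
    using that by (intro sum.cong) (auto simp: idm_def)
  then show "mmul N (idm N) A i k = A i k"
    using A by (auto simp: mmul_def wfm_def not_less)
qed

lemma mtr_mmul: "mtr (mmul N A B) = mmul N (mtr B) (mtr A)"
  by (auto simp: mtr_def mmul_def fun_eq_iff mult.commute)

lemma mtr_simps: "mtr (A + B) = mtr A + mtr B" "mtr (A - B) = mtr A - mtr B"
  "mtr (- A) = - mtr A" "mtr (smul c A) = smul c (mtr A)" "mtr (mtr A) = A"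
  "mtr (idm N) = idm N" "mtr 0 = 0"
  by (auto simp: mtr_def smul_def idm_def fun_eq_iff)

lemma mtr_sum: "mtr (\<Sum>i\<in>I. f i) = (\<Sum>i\<in>I. mtr (f i))"
  by (auto simp: fun_eq_iff mtr_def sum_mat_apply)

lemma minv_eqI:
  assumes "wfm N B" "mmul N A B = idm N" "mmul N B A = idm N"
  shows "minv N A = B"
proof -
  have "B' = B" if "wfm N B'" "mmul N A B' = idm N" for B'
  proof -
    have "B' = mmul N (mmul N B A) B'" using assms that by simp
    also have "\<dots> = mmul N B (mmul N A B')" by (rule mmul_assoc)
    finally show ?thesis using assms that by simp
  qed
  then show ?thesis
    unfolding minv_def using assms by (intro some_equality conjI) blast+
qed

lemma invertible_mD:
  assumes "invertible_m N A"
  shows "wfm N A" "wfm N (minv N A)" "mmul N A (minv N A) = idm N" "mmul N (minv N A) A = idm N"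
proof -
  obtain B where "wfm N A" "wfm N B" "mmul N A B = idm N" "mmul N B A = idm N"
    using assms by (auto simp: invertible_m_def)
  moreover from this have "minv N A = B" by (intro minv_eqI)
  ultimately show "wfm N A" "wfm N (minv N A)" "mmul N A (minv N A) = idm N"
    "mmul N (minv N A) A = idm N" by auto
qed

subsection \<open>Invertibility and the determinant\<close>

text \<open>Bridge to \<open>complex mat\<close>, whose adjugate makes a nonzero determinant imply
  invertibility and writes an inverse as a rational function of the entries.\<close>

definition matN :: "nat \<Rightarrow> cmat \<Rightarrow> complex mat" where
  "matN N A = Matrix.mat N N (\<lambda>(i, k). A i k)"

lemma matN_carrier [simp]: "matN N A \<in> carrier_mat N N"
  by (simp add: matN_def)

lemma det_matN: "Determinant.det (matN N A) = mdet N A"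
proof -
  have "p i < N" if "p permutes {..<N}" "i < N" for p i
    using that permutes_in_image by (metis lessThan_iff)
  then have "(\<Prod>i = 0..<N. matN N A $$ (i, p i)) = (\<Prod>i<N. A i (p i))"
    if "p permutes {..<N}" for p
    using that by (intro prod.cong) (auto simp: matN_def)
  then show ?thesis
    unfolding mdet_def Determinant.det_def'[OF matN_carrier]
    by (intro sum.cong) (auto simp: atLeast0LessThan)
qed

lemma matN_mmul: "matN N (mmul N A B) = matN N A * matN N B"
  by (rule eq_matI) (auto simp: matN_def mmul_def scalar_prod_def atLeast0LessThan)

lemma matN_idm: "matN N (idm N) = 1\<^sub>m N"
  by (rule eq_matI) (auto simp: matN_def idm_def)

definition cadj :: "nat \<Rightarrow> cmat \<Rightarrow> cmat" where
  "cadj N A = (\<lambda>i k. if i < N \<and> k < N then Determinant.cofactor (matN N A) k i else 0)"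

lemma cadj: "mmul N A (cadj N A) = smul (mdet N A) (idm N)"
  "mmul N (cadj N A) A = smul (mdet N A) (idm N)"
proof -
  have adj: "matN N (cadj N A) = adj_mat (matN N A)"
    by (rule eq_matI) (auto simp: matN_def adj_mat_def cadj_def)
  have eqI: "B = C" if "wfm N B" "wfm N C" "matN N B = matN N C" for B C
  proof (intro ext)
    fix i k
    show "B i k = C i k"
    proof (cases "i < N \<and> k < N")
      case True
      then have "matN N B $$ (i, k) = B i k" "matN N C $$ (i, k) = C i k"
        by (auto simp: matN_def)
      then show ?thesis using that(3) by simp
    qed (use that in \<open>auto simp: wfm_def not_less\<close>)
  qed
  have sc: "matN N (smul c (idm N)) = c \<cdot>\<^sub>m 1\<^sub>m N" for c
    by (rule eq_matI) (auto simp: matN_def smul_def idm_def)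
  show "mmul N A (cadj N A) = smul (mdet N A) (idm N)"
    using adj_mat(2)[of "matN N A" N] by (intro eqI) (auto simp: matN_mmul adj sc det_matN)
  show "mmul N (cadj N A) A = smul (mdet N A) (idm N)"
    using adj_mat(3)[of "matN N A" N] by (intro eqI) (auto simp: matN_mmul adj sc det_matN)
qed

lemma wfm_cadj [simp]: "wfm N (cadj N A)"
  by (auto simp: wfm_def cadj_def)

lemma invertible_m_mdet:
  assumes "wfm N A" "mdet N A \<noteq> 0"
  shows "invertible_m N A"
  unfolding invertible_m_def
proof (intro conjI exI)
  let ?B = "smul (inverse (mdet N A)) (cadj N A)"
  show "mmul N A ?B = idm N" "mmul N ?B A = idm N" "wfm N ?B" "wfm N A"
    using assms by (auto simp: mmul_distribs cadj)
qed

lemma mdet_nonzero: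
  assumes "mmul N A B = idm N"
  shows "mdet N A \<noteq> 0"
proof -
  have "Determinant.det (matN N A) * Determinant.det (matN N B) = 1"
    using assms by (metis Determinant.det_mult matN_carrier matN_mmul matN_idm Determinant.det_one)
  then show ?thesis by (auto simp: det_matN)
qed

lemma minv_cadj:
  assumes "mmul N A B = idm N"
  shows "minv N A = smul (inverse (mdet N A)) (cadj N A)"
  using mdet_nonzero[OF assms] by (intro minv_eqI) (auto simp: mmul_distribs cadj)

subsection \<open>Entrywise derivatives\<close>

text \<open>Bundles existence and value of the derivative: \<open>pdx\<close> and \<open>pdt\<close>
  alone are choices that say nothing where no derivative exists.\<close>

definition has_mderiv :: "(real \<Rightarrow> cmat) \<Rightarrow> cmat \<Rightarrow> real \<Rightarrow> bool" where
  "has_mderiv f D x \<longleftrightarrow> (\<forall>i k. ((\<lambda>y. f y i k) has_vector_derivative D i k) (at x))"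

lemma has_mderiv_const: "has_mderiv (\<lambda>y. A) 0 x"
  by (auto simp: has_mderiv_def)

lemma has_mderiv_add:
  "has_mderiv f D x \<Longrightarrow> has_mderiv g E x \<Longrightarrow> has_mderiv (\<lambda>y. f y + g y) (D + E) x"
  by (auto simp: has_mderiv_def intro!: has_vector_derivative_add)

lemma has_mderiv_diff:
  "has_mderiv f D x \<Longrightarrow> has_mderiv g E x \<Longrightarrow> has_mderiv (\<lambda>y. f y - g y) (D - E) x"
  by (auto simp: has_mderiv_def intro!: has_vector_derivative_diff)

lemma has_mderiv_smul:
  "has_mderiv f D x \<Longrightarrow> has_mderiv (\<lambda>y. smul c (f y)) (smul c D) x"
  by (auto simp: has_mderiv_def smul_def intro!: has_vector_derivative_mult_right)

lemma has_mderiv_mtr: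
  "has_mderiv f D x \<Longrightarrow> has_mderiv (\<lambda>y. mtr (f y)) (mtr D) x"
  by (auto simp: has_mderiv_def mtr_def)

lemma has_mderiv_sum:
  "(\<And>i. i \<in> I \<Longrightarrow> has_mderiv (f i) (D i) x) \<Longrightarrow>
    has_mderiv (\<lambda>y. \<Sum>i\<in>I. f i y) (\<Sum>i\<in>I. D i) x"
  by (auto simp: has_mderiv_def sum_mat_apply intro!: has_vector_derivative_sum)

lemma has_mderiv_mmul:
  assumes "has_mderiv f D x" "has_mderiv g E x"
  shows "has_mderiv (\<lambda>y. mmul N (f y) (g y)) (mmul N D (g x) + mmul N (f x) E) x"
  unfolding has_mderiv_def
proof (intro allI)
  fix i k
  have "((\<lambda>y. \<Sum>l<N. f y i l * g y l k) has_vector_derivative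
      (\<Sum>l<N. f x i l * E l k + D i l * g x l k)) (at x)"
    using assms by (intro has_vector_derivative_sum has_vector_derivative_mult)
      (auto simp: has_mderiv_def)
  then show "((\<lambda>y. mmul N (f y) (g y) i k) has_vector_derivative
      (mmul N D (g x) + mmul N (f x) E) i k) (at x)"
    by (auto simp: mmul_def sum.distrib add.commute)
qed

lemma has_mderiv_unique: "has_mderiv f D x \<Longrightarrow> has_mderiv f E x \<Longrightarrow> D = E"
  unfolding has_mderiv_def by (intro ext) (metis vector_derivative_unique_at)

lemma differentiable_det:
  assumes "\<And>y. M y \<in> carrier_mat n n"
    and "\<And>i k. i < n \<Longrightarrow> k < n \<Longrightarrow> (\<lambda>y. M y $$ (i, k)) differentiable (at x)"
  shows "(\<lambda>y. Determinant.det (M y) :: complex) differentiable (at (x::real))"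
proof -
  have prod: "(\<lambda>y. \<Prod>i\<in>I. h i y) differentiable (at x)"
    if "\<And>i. i \<in> I \<Longrightarrow> h i differentiable (at x)" for I :: "nat set" and h :: "nat \<Rightarrow> real \<Rightarrow> complex"
  proof (cases "finite I")
    case True
    then show ?thesis using that
      by (induction I rule: finite_induct) (simp_all add: differentiable_mult)
  qed simp
  have ent: "(\<lambda>y. of_int (sign p) * (\<Prod>i = 0..<n. M y $$ (i, p i))) differentiable (at x)"
    if p: "p permutes {0..<n}" for p
  proof (rule differentiable_mult[OF differentiable_const], rule prod)
    fix i assume i: "i \<in> {0..<n}"
    then have "p i < n"
      using p permutes_in_image by (metis atLeastLessThan_iff)
    then show "(\<lambda>y. M y $$ (i, p i)) differentiable (at x)"
      using assms(2) i by simp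
  qed
  show ?thesis
    unfolding Determinant.det_def'[OF assms(1)]
  proof (rule differentiable_sum)
    show "finite {p. p permutes {0..<n}}" by (simp add: finite_permutations)
  qed (use ent in blast)
qed

text \<open>By Cramer's rule every entry is a polynomial in the entries of \<open>f\<close> over a
  nonvanishing determinant. Existence is enough: the derivative of interest is computed later by
  differentiating a matrix identity.\<close>

lemma has_mderiv_minv:
  assumes f: "has_mderiv f D x" and inv: "\<And>y. invertible_m N (f y)"
  shows "\<exists>E. has_mderiv (\<lambda>y. minv N (f y)) E x"
proof -
  have ent: "(\<lambda>y. f y i k) differentiable (at x)" for i k
    using f by (auto simp: has_mderiv_def differentiable_def has_vector_derivative_def)
  have d: "(\<lambda>y. mdet N (f y)) differentiable (at x)"
    unfolding det_matN[symmetric]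
    by (rule differentiable_det[where n = N]) (auto simp: matN_def ent)
  have c: "(\<lambda>y. cadj N (f y) i k) differentiable (at x)" for i k
  proof (cases "i < N \<and> k < N")
    case True
    have "(\<lambda>y. Determinant.det (mat_delete (matN N (f y)) k i)) differentiable (at x)"
    proof (rule differentiable_det[where n = "N - 1"])
      show "mat_delete (matN N (f y)) k i \<in> carrier_mat (N - 1) (N - 1)" for y
        by (rule mat_delete_carrier[OF matN_carrier])
      fix r s assume "r < N - 1" "s < N - 1"
      then have "mat_delete (matN N (f y)) k i $$ (r, s)
          = f y (if r < k then r else Suc r) (if s < i then s else Suc s)" for y
        by (simp add: mat_delete_def matN_def)
      then show "(\<lambda>y. mat_delete (matN N (f y)) k i $$ (r, s)) differentiable (at x)"
        by (simp only: ent)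
    qed
    then show ?thesis
      using True unfolding cadj_def Determinant.cofactor_def by (simp only: if_True simp_thms) (intro differentiable_mult differentiable_const)
  qed (auto simp: cadj_def)
  have nz: "mdet N (f y) \<noteq> 0" for y
    using invertible_mD(3)[OF inv] by (rule mdet_nonzero)
  have "(\<lambda>y. minv N (f y) i k) differentiable (at x)" for i k
  proof -
    have "minv N (f y) i k = inverse (mdet N (f y)) * cadj N (f y) i k" for y
      using minv_cadj[OF invertible_mD(3)[OF inv]] by (simp add: smul_def)
    then show ?thesis
      using d c nz by (simp only:) (intro differentiable_mult differentiable_inverse)
  qed
  then have "has_mderiv (\<lambda>y. minv N (f y))
      (\<lambda>i k. vector_derivative (\<lambda>y. minv N (f y) i k) (at x)) x"
    unfolding has_mderiv_def by (simp only: vector_derivative_works) blast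
  then show ?thesis by blast
qed

lemma diffx_pdxI:
  assumes "\<And>x t. has_mderiv (\<lambda>y. f y t) (D x t) x"
  shows "diffx f" "pdx f = D"
proof -
  show "diffx f"
    using assms unfolding diffx_def has_mderiv_def
    by (blast intro: differentiableI_vector)
  show "pdx f = D"
    using assms unfolding pdx_def has_mderiv_def
    by (intro ext vector_derivative_at) blast
qed

lemma difft_pdtI:
  assumes "\<And>x t. has_mderiv (\<lambda>s. f x s) (D x t) t"
  shows "difft f" "pdt f = D"
proof -
  show "difft f"
    using assms unfolding difft_def has_mderiv_def
    by (blast intro: differentiableI_vector)
  show "pdt f = D"
    using assms unfolding pdt_def has_mderiv_def
    by (intro ext vector_derivative_at) blast
qed

lemma diffxD: "diffx f \<Longrightarrow> has_mderiv (\<lambda>y. f y t) (pdx f x t) x"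
  unfolding diffx_def has_mderiv_def pdx_def vector_derivative_works by blast

lemma difftD: "difft f \<Longrightarrow> has_mderiv (\<lambda>s. f x s) (pdt f x t) t"
  unfolding difft_def has_mderiv_def pdt_def vector_derivative_works by blast

lemma wfm_has_mderiv:
  assumes "has_mderiv f D x" "\<And>y. wfm N (f y)"
  shows "wfm N D"
  unfolding wfm_def
proof (intro allI impI)
  fix i k assume "N \<le> i \<or> N \<le> k"
  then have *: "f y i k = 0" for y
    using assms(2)[of y] by (auto simp: wfm_def)
  have "((\<lambda>y. f y i k) has_vector_derivative D i k) (at x)"
    using assms(1) by (simp add: has_mderiv_def)
  then have "((\<lambda>y. 0) has_vector_derivative D i k) (at x)"
    by (simp add: *)
  then show "D i k = 0"
    using vector_derivative_unique_at[OF _ has_vector_derivative_const] by blast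
qed

subsection \<open>The bilinear form\<close>

context
  fixes m n :: nat
begin

text \<open>In 0-based indices \<open>Cmn\<close> is a signed permutation matrix: row
  \<open>i\<close> has its only entry \<open>eps i\<close> in column \<open>rho i\<close>, and
  \<open>rho\<close> reverses each of the two diagonal blocks.\<close>

private definition rho :: "nat \<Rightarrow> nat" where
  "rho i = (if i < 2*m then 2*m - 1 - i else 4*m + 2*n - i)"

private definition eps :: "nat \<Rightarrow> complex" where
  "eps i = (if i < 2*m then 1 else (-1) ^ (n + i))"

lemma Cmn_entry: "Cmn m n i k = (if i < Nd m n \<and> k = rho i then eps i else 0)"
proof -
  have "(\<Sum>l\<in>{1..2*m}. Em l (2*m + 1 - l) i k)
      = (\<Sum>l\<in>{1..2*m}. if l = i + 1 then (if k = rho i then 1 else 0) else 0)"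
    by (rule sum.cong) (auto simp: Em_def rho_def)
  also have "\<dots> = (if i < 2*m \<and> k = rho i then 1 else 0)"
    by auto
  finally have 1: "(\<Sum>l\<in>{1..2*m}. Em l (2*m + 1 - l) i k) = (if i < 2*m \<and> k = rho i then 1 else 0)" .
  have "(\<Sum>l\<in>{1..2*n+1}. smul ((-1) ^ (n + l - 1)) (Em (2*m + l) (2*m + 2*n + 2 - l)) i k)
      = (\<Sum>l\<in>{1..2*n+1}. if l = i + 1 - 2*m then (if 2*m \<le> i \<and> k = rho i then eps i else 0) else 0)"
  proof (rule sum.cong)
    fix l assume l: "l \<in> {1..2*n+1}"
    show "smul ((-1) ^ (n + l - 1)) (Em (2*m + l) (2*m + 2*n + 2 - l)) i k
        = (if l = i + 1 - 2*m then (if 2*m \<le> i \<and> k = rho i then eps i else 0) else 0)"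
    proof (cases "i = 2*m + (l - 1)")
      case True
      obtain r where r: "l = Suc r" using l by (cases l) auto
      from True l have "rho i = 2*m + 2*n + 2 - l - 1" "eps i = (-1) ^ (n + l - 1)"
        unfolding r by (auto simp: rho_def eps_def power_add power_mult)
      then show ?thesis using True l by (simp add: smul_def Em_def) linarith
    next
      case False
      then show ?thesis using l by (auto simp: smul_def Em_def)
    qed
  qed simp
  also have "\<dots> = (if 2*m \<le> i \<and> i < Nd m n \<and> k = rho i then eps i else 0)"
    by (auto simp: Nd_def)
  finally show ?thesis
    using 1 unfolding Cmn_def by (auto simp: sum_mat_apply eps_def Nd_def)
qed

private lemma rho_less: "i < Nd m n \<Longrightarrow> rho i < Nd m n"
  and rho_rho: "i < Nd m n \<Longrightarrow> rho (rho i) = i"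
  by (auto simp: rho_def Nd_def split: if_splits)

text \<open>In the second block \<open>i + rho i = 4*m + 2*n\<close> is even, so paired rows have
  equal signs; this makes \<open>Cmn\<close> symmetric and an involution.\<close>

private lemma eps_rho: "i < Nd m n \<Longrightarrow> eps (rho i) = eps i"
proof (cases "i < 2*m")
  case False
  assume "i < Nd m n"
  then have "even (n + rho i) = even (n + i)" "\<not> rho i < 2*m"
    using False by (auto simp: rho_def Nd_def)
  then show ?thesis
    using False by (simp add: eps_def minus_one_power_iff)
qed (auto simp: eps_def rho_def)

private lemma eps_sq: "eps i * eps i = 1"
  by (simp add: eps_def minus_one_power_iff)

lemma wfm_Cmn [simp]: "wfm (Nd m n) (Cmn m n)"
  unfolding wfm_def using rho_less by (auto simp: Cmn_entry not_less[symmetric])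

lemma mtr_Cmn: "mtr (Cmn m n) = Cmn m n"
proof (intro ext)
  fix i k
  have "i < Nd m n \<and> k = rho i \<longleftrightarrow> k < Nd m n \<and> i = rho k"
    using rho_less[of i] rho_less[of k] rho_rho[of i] rho_rho[of k] by auto
  then show "mtr (Cmn m n) i k = Cmn m n i k"
    by (auto simp: mtr_def Cmn_entry eps_rho)
qed

text \<open>As \<open>Cmn\<close> is its own inverse, the \<open>C Y^t C^{-1}\<close> of
  \<open>sigma\<close> and the \<open>C^{-1} A^t C\<close> of the adjoint are the same operation,
  and \<open>adj\<close> can serve for both.\<close>

lemma Cmn_square: "mmul (Nd m n) (Cmn m n) (Cmn m n) = idm (Nd m n)"
proof (intro ext)
  fix i k
  show "mmul (Nd m n) (Cmn m n) (Cmn m n) i k = idm (Nd m n) i k"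
  proof (cases "i < Nd m n \<and> k < Nd m n")
    case True
    have "(\<Sum>l<Nd m n. Cmn m n i l * Cmn m n l k)
        = (\<Sum>l<Nd m n. if l = rho i then eps i * Cmn m n (rho i) k else 0)"
      using True by (intro sum.cong) (auto simp: Cmn_entry[of i])
    also have "\<dots> = eps i * Cmn m n (rho i) k"
      using True rho_less by simp
    also have "\<dots> = (if i = k then 1 else 0)"
      using True rho_less[of i] rho_rho[of i] eps_rho[of i] eps_sq[of i]
      by (auto simp: Cmn_entry)
    finally show ?thesis using True by (simp add: mmul_def idm_def)
  qed (auto simp: mmul_def idm_def)
qed

lemma minv_Cmn: "minv (Nd m n) (Cmn m n) = Cmn m n"
  by (rule minv_eqI) (simp_all add: Cmn_square)

lemma adj_eq: "adj m n A = mmul (Nd m n) (Cmn m n) (mmul (Nd m n) (mtr A) (Cmn m n))"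
  by (simp add: adj_def minv_Cmn mmul_assoc)

lemma adj_simps: "adj m n (A + B) = adj m n A + adj m n B"
  "adj m n (A - B) = adj m n A - adj m n B"
  "adj m n (- A) = - adj m n A"
  "adj m n (smul c A) = smul c (adj m n A)"
  "adj m n 0 = 0"
  "adj m n (idm (Nd m n)) = idm (Nd m n)"
  by (simp_all add: adj_eq mtr_simps mmul_distribs Cmn_square)

lemma adj_mmul: "adj m n (mmul (Nd m n) A B) = mmul (Nd m n) (adj m n B) (adj m n A)"
proof -
  have "mmul (Nd m n) (Cmn m n) (mmul (Nd m n) (Cmn m n) X) = mmul (Nd m n) (idm (Nd m n)) X" for X
    by (simp only: mmul_assoc[symmetric] Cmn_square)
  then have "mmul (Nd m n) Y (mmul (Nd m n) (Cmn m n) (mmul (Nd m n) (Cmn m n) (mmul (Nd m n) X Z)))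
      = mmul (Nd m n) Y (mmul (Nd m n) X Z)" for X Y Z
    by simp
  then show ?thesis
    by (simp add: adj_eq mtr_mmul mmul_assoc)
qed

lemma adj_sum: "adj m n (\<Sum>i\<in>I. f i) = (\<Sum>i\<in>I. adj m n (f i))"
  by (simp add: adj_eq mtr_sum mmul_sum_left mmul_sum_right)

lemma adj_adj: "wfm (Nd m n) A \<Longrightarrow> adj m n (adj m n A) = A"
proof -
  assume A: "wfm (Nd m n) A"
  have "adj m n (adj m n A) = mmul (Nd m n) (mmul (Nd m n) (Cmn m n) (Cmn m n))
      (mmul (Nd m n) A (mmul (Nd m n) (Cmn m n) (Cmn m n)))"
    by (simp only: adj_eq mtr_mmul mtr_Cmn mtr_simps mmul_assoc)
  then show ?thesis using A by (simp add: Cmn_square)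
qed

lemma wfm_adj [simp]: "wfm (Nd m n) (adj m n A)"
  by (simp add: adj_eq)

lemma has_mderiv_adj: "has_mderiv f D x \<Longrightarrow> has_mderiv (\<lambda>y. adj m n (f y)) (adj m n D) x"
  unfolding adj_eq
  using has_mderiv_mmul[OF has_mderiv_const has_mderiv_mmul[OF has_mderiv_mtr has_mderiv_const],
      of f D x "Nd m n" "Cmn m n" "Nd m n" "Cmn m n"]
  by simp

lemma sigma_adj: "sigma m n Y = minv (Nd m n) (adj m n Y)"
  by (simp add: sigma_def adj_eq minv_Cmn mmul_assoc)

lemma sigma_star_adj: "sigma_star m n Y = - adj m n Y"
  by (simp add: sigma_star_def adj_eq minv_Cmn mmul_assoc)

text \<open>The reality condition says that the inverse of \<open>F (z)\<close> is the adjoint of \<open>F (- z)\<close>.\<close>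
lemma adj_inverse:
  assumes "sigma m n Y = X" "invertible_m (Nd m n) Y"
  shows "mmul (Nd m n) X (adj m n Y) = idm (Nd m n)" "mmul (Nd m n) (adj m n Y) X = idm (Nd m n)"
    "minv (Nd m n) X = adj m n Y"
proof -
  note Y = invertible_mD[OF assms(2)]
  have "mmul (Nd m n) (adj m n Y) (adj m n (minv (Nd m n) Y)) = idm (Nd m n)"
    "mmul (Nd m n) (adj m n (minv (Nd m n) Y)) (adj m n Y) = idm (Nd m n)"
    by (simp_all only: adj_mmul[symmetric] Y adj_simps)
  then have "invertible_m (Nd m n) (adj m n Y)"
    unfolding invertible_m_def using wfm_adj by blast
  from invertible_mD[OF this] assms(1)
  show 1: "mmul (Nd m n) X (adj m n Y) = idm (Nd m n)" "mmul (Nd m n) (adj m n Y) X = idm (Nd m n)"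
    by (simp_all add: sigma_adj)
  then show "minv (Nd m n) X = adj m n Y"
    by (intro minv_eqI) simp_all
qed

end

subsection \<open>Images of matrices\<close>

lemma mvec_mmul: "mvec N (mmul N A B) v = mvec N A (mvec N B v)"
proof
  fix i
  have "(\<Sum>l<N. (\<Sum>r<N. A i r * B r l) * v l) = (\<Sum>r<N. A i r * (\<Sum>l<N. B r l * v l))"
    by (simp add: sum_distrib_left sum_distrib_right mult.assoc) (rule sum.swap)
  then show "mvec N (mmul N A B) v i = mvec N A (mvec N B v) i"
    by (simp add: mvec_def mmul_def)
qed

lemma mvec_vecs [simp]: "mvec N A v \<in> vecs N"
  by (simp add: mvec_def vecs_def)

lemma mimage_mmul: "mvec N A ` mimage N B = mimage N (mmul N A B)"
  by (simp add: mimage_def image_image mvec_mmul)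

lemma mimage_mmul_subset: "mimage N (mmul N A B) \<subseteq> mimage N A"
  by (auto simp: mimage_def mvec_mmul)

text \<open>An idempotent fixes its range, and the columns of \<open>A\<close>, its values at unit
  vectors, lie there. This turns inclusions of ranges into matrix identities.\<close>

lemma mimage_subset_fixed:
  assumes "mimage N A \<subseteq> mimage N P" "mmul N P P = P" "wfm N A"
  shows "mmul N P A = A"
proof (intro ext)
  fix i k
  show "mmul N P A i k = A i k"
  proof (cases "i < N \<and> k < N")
    case True
    define u :: cvec where "u = (\<lambda>r. if r = k then 1 else 0)"
    have u: "u \<in> vecs N" using True by (auto simp: u_def vecs_def)
    then obtain v where "mvec N A u = mvec N P v"
      using assms(1) by (auto simp: mimage_def)
    then have "mvec N (mmul N P A) u = mvec N A u"
      using assms(2) by (metis mvec_mmul)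
    then have "mvec N (mmul N P A) u i = mvec N A u i"
      by simp
    moreover have col: "mvec N B u i = B i k" for B
      using True by (simp add: mvec_def u_def sum.delta if_distrib[of "\<lambda>c. _ * c"] cong: if_cong)
    ultimately show ?thesis by (simp only: col)
  next
    case False
    then show ?thesis using assms(3) by (auto simp: mmul_def wfm_def)
  qed
qed

subsection \<open>Moving projections\<close>

text \<open>Differentiate \<open>R S = 1\<close> and multiply by \<open>S\<close> from the left. For
  frames the inverse is an adjoint, so its derivative \<open>E\<close> is available
  beforehand.\<close>

lemma has_mderiv_inverse:
  assumes "has_mderiv R D x" "has_mderiv S E x"
    and "\<And>y. mmul N (R y) (S y) = idm N" "\<And>y. mmul N (S y) (R y) = idm N" "\<And>y. wfm N (S y)"
  shows "E = - mmul N (S x) (mmul N D (S x))"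
proof -
  have "has_mderiv (\<lambda>y. mmul N (R y) (S y)) (mmul N D (S x) + mmul N (R x) E) x"
    by (intro has_mderiv_mmul assms)
  then have "mmul N D (S x) + mmul N (R x) E = 0"
    using has_mderiv_unique has_mderiv_const unfolding assms(3) by blast
  then have "mmul N (S x) (mmul N D (S x) + mmul N (R x) E) = 0"
    by simp
  moreover have "mmul N (S x) (mmul N (R x) E) = E"
    using wfm_has_mderiv[OF assms(2,5)] by (simp add: mmul_assoc[symmetric] assms(4))
  ultimately show ?thesis
    by (simp add: mmul_add_right eq_neg_iff_add_eq_0 add.commute)
qed

text \<open>\<open>P\<close> is the projection onto the range of \<open>Mp\<close> along the range of \<open>Mq\<close>.\<close>
lemma projection_deriv:
  assumes "has_mderiv Mp (- mmul N Ap (Mp x)) x" "has_mderiv Mq (- mmul N Aq (Mq x)) x"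
    and R: "\<And>y. R y = Mp y + Mq y"
    and S: "\<And>y. mmul N (R y) (S y) = idm N" "\<And>y. mmul N (S y) (R y) = idm N"
      "\<And>y. wfm N (S y)" "\<And>y. wfm N (R y)"
    and P: "\<And>y. mmul N (P y) (R y) = Mp y" "\<And>y. mmul N (P y) (P y) = P y" "\<And>y. wfm N (P y)"
  shows "has_mderiv P (mmul N (P x) (mmul N Aq (idm N - P x))
      - mmul N (idm N - P x) (mmul N Ap (P x))) x"
proof -
  let ?M = "mmul N"
  have dR: "has_mderiv R (- ?M Ap (Mp x) + - ?M Aq (Mq x)) x"
    using has_mderiv_add[OF assms(1,2)] unfolding R[symmetric] .
  have inv: "invertible_m N (R y)" for y
    unfolding invertible_m_def using S by blast
  have S_eq: "minv N (R y) = S y" for y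
    by (intro minv_eqI S)
  have P_eq: "P y = ?M (Mp y) (S y)" for y
    using P(3)[of y] by (simp add: P(1)[symmetric] mmul_assoc S)
  \<comment> \<open>\<open>P = Mp R^{-1}\<close> is used only to see that \<open>P\<close> has some
    derivative \<open>D\<close>.\<close>
  obtain E where E: "has_mderiv S E x"
    using has_mderiv_minv[OF dR inv] unfolding S_eq by blast
  obtain D where D: "has_mderiv P D x"
    using has_mderiv_mmul[OF assms(1) E, of N] unfolding P_eq[symmetric] by blast
  have wD: "wfm N D"
    using wfm_has_mderiv[OF D P(3)] .
  have Mp: "Mp x = ?M (P x) (R x)" and Mq: "Mq x = ?M (idm N - P x) (R x)"
    using P(1)[of x] S(4)[of x] R[of x] by (simp_all only: mmul_diff_left mmul_idm_left) simp
  \<comment> \<open>The value of \<open>D\<close> comes from differentiating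
    \<open>P R = Mp\<close>, writing \<open>Mp = P R\<close> and \<open>Mq = (1 - P) R\<close>, and
    cancelling the invertible \<open>R\<close>.\<close>
  have "has_mderiv Mp (?M D (R x) + ?M (P x) (- ?M Ap (Mp x) + - ?M Aq (Mq x))) x"
    using has_mderiv_mmul[OF D dR, of N] unfolding P(1) .
  then have "?M D (R x) + ?M (P x) (- ?M Ap (Mp x) + - ?M Aq (Mq x)) = - ?M Ap (Mp x)"
    using has_mderiv_unique assms(1) by blast
  then have "?M D (R x) = ?M (?M (P x) (?M Ap (P x)) + ?M (P x) (?M Aq (idm N - P x)) - ?M Ap (P x)) (R x)"
    unfolding Mp Mq by (simp add: mmul_distribs) (simp add: algebra_simps)
  then have "?M (?M D (R x)) (S x)
      = ?M (?M (?M (P x) (?M Ap (P x)) + ?M (P x) (?M Aq (idm N - P x)) - ?M Ap (P x)) (R x)) (S x)"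
    by simp
  then have "D = ?M (P x) (?M Ap (P x)) + ?M (P x) (?M Aq (idm N - P x)) - ?M Ap (P x)"
    using wD by (simp only: mmul_assoc S) simp
  also have "\<dots> = ?M (P x) (?M Aq (idm N - P x)) - ?M (idm N - P x) (?M Ap (P x))"
    by (simp add: mmul_distribs algebra_simps)
  finally show ?thesis using D by simp
qed

subsection \<open>Permutability of the projections\<close>

definition Tmat :: "nat \<Rightarrow> complex \<Rightarrow> cmat \<Rightarrow> cmat" where
  "Tmat N a P = smul (2 * a) P - smul a (idm N)"

lemma wfm_Tmat [simp]: "wfm N P \<Longrightarrow> wfm N (Tmat N a P)"
  by (simp add: Tmat_def)

lemma smul_cancel: "c \<noteq> 0 \<Longrightarrow> smul c A = smul c B \<Longrightarrow> A = B"
  by (simp add: smul_def fun_eq_iff)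

context
  fixes N :: nat and a1 a2 :: complex and P1 P2 phi psi :: cmat
  assumes P1: "wfm N P1" "mmul N P1 P1 = P1" and P2: "wfm N P2" "mmul N P2 P2 = P2"
    and phi: "phi = smul (a1 - a2) (idm N) + smul (2 * a2) P2 - smul (2 * a1) P1"
    and psi: "wfm N psi" "mmul N phi psi = idm N" "mmul N psi phi = idm N"
begin

text \<open>With \<open>phi = T2 - T1\<close>, the mixed products cancel in
  \<open>phi T1 + T2 phi\<close>, which leaves the scalar \<open>a2^2 - a1^2\<close>; multiply by
  \<open>psi\<close> from the right and rewrite \<open>T\<close> in terms of the
  projections.\<close>

lemma conj_first:
  "smul (2 * a1) (mmul N (mmul N phi P1) psi)
    = smul (a2\<^sup>2 - a1\<^sup>2) psi - smul (2 * a2) P2 + smul (a1 + a2) (idm N)"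
proof -
  have "smul (2 * a1) (mmul N phi P1)
      = smul (a2\<^sup>2 - a1\<^sup>2) (idm N) - mmul N (smul (2 * a2) P2 - smul (a1 + a2) (idm N)) phi"
    using P1 P2 unfolding phi
    by (simp add: mmul_distribs) (simp add: fun_eq_iff smul_def algebra_simps power2_eq_square)
  then have "mmul N (smul (2 * a1) (mmul N phi P1)) psi
      = mmul N (smul (a2\<^sup>2 - a1\<^sup>2) (idm N) - mmul N (smul (2 * a2) P2 - smul (a1 + a2) (idm N)) phi) psi"
    by simp
  then show ?thesis
    using psi P1 P2 by (simp add: mmul_distribs)
qed

text \<open>Likewise \<open>phi T2 + T1 phi = a2^2 - a1^2\<close>. That the scalar is the same as in
  \<open>conj_first\<close> is what makes the two Darboux steps commute.\<close>

lemma conj_second: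
  "smul (2 * a2) (mmul N (mmul N phi P2) psi)
    = smul (a2\<^sup>2 - a1\<^sup>2) psi - smul (2 * a1) P1 + smul (a1 + a2) (idm N)"
proof -
  have "smul (2 * a2) (mmul N phi P2)
      = smul (a2\<^sup>2 - a1\<^sup>2) (idm N) - mmul N (smul (2 * a1) P1 - smul (a1 + a2) (idm N)) phi"
    using P1 P2 unfolding phi
    by (simp add: mmul_distribs) (simp add: fun_eq_iff smul_def algebra_simps power2_eq_square)
  then have "mmul N (smul (2 * a2) (mmul N phi P2)) psi
      = mmul N (smul (a2\<^sup>2 - a1\<^sup>2) (idm N) - mmul N (smul (2 * a1) P1 - smul (a1 + a2) (idm N)) phi) psi"
    by simp
  then show ?thesis
    using psi P1 P2 by (simp add: mmul_distribs)
qed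

lemma conj_idem:
  assumes "mmul N P P = P"
  shows "mmul N (mmul N (mmul N phi P) psi) (mmul N (mmul N phi P) psi) = mmul N (mmul N phi P) psi"
proof -
  have "mmul N psi (mmul N phi X) = mmul N (idm N) X" for X
    by (simp only: mmul_assoc[symmetric] psi)
  moreover have "mmul N P (mmul N P X) = mmul N P X" for X
    by (simp only: mmul_assoc[symmetric] assms)
  ultimately show ?thesis by (simp add: mmul_assoc)
qed

text \<open>\<open>T1\<close> is \<open>a1\<close> on the range of \<open>P1\<close> and
  \<open>- a1\<close> on its kernel, so there the scalar can be replaced by \<open>T1\<close>, and
  \<open>T1 - T2 = - phi\<close>.\<close>

lemma phi_on_first: "mmul N (smul a1 (idm N) - Tmat N a2 P2) P1 = - mmul N phi P1"
  "mmul N (smul (- a1) (idm N) - Tmat N a2 P2) (idm N - P1) = - mmul N phi (idm N - P1)"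
  using P1 P2 unfolding phi Tmat_def
  by (simp_all add: mmul_distribs) (simp_all add: fun_eq_iff smul_def algebra_simps)

lemma phi_on_second: "mmul N (smul a2 (idm N) - Tmat N a1 P1) P2 = mmul N phi P2"
  "mmul N (smul (- a2) (idm N) - Tmat N a1 P1) (idm N - P2) = mmul N phi (idm N - P2)"
  using P1 P2 unfolding phi Tmat_def
  by (simp_all add: mmul_distribs) (simp_all add: fun_eq_iff smul_def algebra_simps)

end

text \<open>The adjoint of \<open>phi P1 psi\<close> is \<open>psi P1 phi\<close>, which does not
  look like the same matrix. But \<open>conj_first\<close> and \<open>conj_second\<close> express
  the conjugates linearly in \<open>psi\<close>, the original projections and the identity, all
  self-adjoint; then divide by \<open>2 * a1\<close> or \<open>2 * a2\<close>.\<close>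

lemma Oproj_conj:
  assumes P: "Oproj m n P1" "Oproj m n P2"
    and phi: "phi = smul (a1 - a2) (idm (Nd m n)) + smul (2 * a2) P2 - smul (2 * a1) P1"
    and inv: "invertible_m (Nd m n) phi" and "a1 \<noteq> 0" "a2 \<noteq> 0"
  shows "Oproj m n (mmul (Nd m n) (mmul (Nd m n) phi P1) (minv (Nd m n) phi))"
    "Oproj m n (mmul (Nd m n) (mmul (Nd m n) phi P2) (minv (Nd m n) phi))"
proof -
  let ?N = "Nd m n" and ?psi = "minv (Nd m n) phi"
  note psi = invertible_mD[OF inv]
  have W: "wfm ?N P1" "mmul ?N P1 P1 = P1" "wfm ?N P2" "mmul ?N P2 P2 = P2"
    and A: "adj m n P1 = P1" "adj m n P2 = P2"
    using P by (auto simp: Oproj_def)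
  have phi_adj: "adj m n phi = phi"
    by (simp add: phi adj_simps A)
  have "minv ?N phi = adj m n ?psi"
  proof (rule minv_eqI)
    have "mmul ?N (adj m n phi) (adj m n ?psi) = idm ?N"
      by (simp only: adj_mmul[symmetric] psi adj_simps)
    then show "mmul ?N phi (adj m n ?psi) = idm ?N" by (simp only: phi_adj)
    have "mmul ?N (adj m n ?psi) (adj m n phi) = idm ?N"
      by (simp only: adj_mmul[symmetric] psi adj_simps)
    then show "mmul ?N (adj m n ?psi) phi = idm ?N" by (simp only: phi_adj)
  qed simp
  then have psi_adj: "adj m n ?psi = ?psi" by simp
  note conj = conj_first[OF W phi psi(2-4)] conj_second[OF W phi psi(2-4)]
  let ?t1 = "mmul ?N (mmul ?N phi P1) ?psi" and ?t2 = "mmul ?N (mmul ?N phi P2) ?psi"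
  have "adj m n (smul (2 * a1) ?t1) = smul (2 * a1) ?t1"
    unfolding conj by (simp add: adj_simps A psi_adj)
  then have "adj m n ?t1 = ?t1"
    using \<open>a1 \<noteq> 0\<close> smul_cancel[of "2 * a1"] by (simp add: adj_simps)
  then show "Oproj m n ?t1"
    unfolding Oproj_def using conj_idem[OF W phi psi(2-4) W(2)] by simp
  have "adj m n (smul (2 * a2) ?t2) = smul (2 * a2) ?t2"
    unfolding conj by (simp add: adj_simps A psi_adj)
  then have "adj m n ?t2 = ?t2"
    using \<open>a2 \<noteq> 0\<close> smul_cancel[of "2 * a2"] by (simp add: adj_simps)
  then show "Oproj m n ?t2"
    unfolding Oproj_def using conj_idem[OF W phi psi(2-4) W(4)] by simp
qed

subsection \<open>Formal series\<close>

text \<open>\<open>sbound\<close> is an unspecified choice among the upper bounds of the degree;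
  calculations need a bound that is known.\<close>

definition bnd :: "int \<Rightarrow> cser \<Rightarrow> bool" where
  "bnd d A \<longleftrightarrow> (\<forall>i>d. A i = 0)"

definition wfs :: "nat \<Rightarrow> cser \<Rightarrow> bool" where
  "wfs N A \<longleftrightarrow> (\<forall>i. wfm N (A i))"

lemma bnd_mono: "bnd d A \<Longrightarrow> d \<le> e \<Longrightarrow> bnd e A"
  by (auto simp: bnd_def)

lemma sbounded_iff: "sbounded A \<longleftrightarrow> (\<exists>d. bnd d A)"
  by (simp add: sbounded_def bnd_def)

lemma bnd_sbound: "bnd d A \<Longrightarrow> bnd (sbound A) A"
  unfolding bnd_def sbound_def by (rule someI)

text \<open>Makes the product independent of the chosen bounds: both sums equal the one over the
  union of the index sets, the extra terms being zero.\<close>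

lemma smult_eq_sum:
  assumes "bnd a A" "bnd b B" "finite I" "\<And>i. i \<notin> I \<Longrightarrow> A i = 0 \<or> B (k - i) = 0"
  shows "Defs.smult N A B k = (\<Sum>i\<in>I. mmul N (A i) (B (k - i)))"
proof -
  let ?I = "{k - sbound B .. sbound A}"
  have *: "A i = 0 \<or> B (k - i) = 0" if "i \<notin> ?I" for i
    using that bnd_sbound[OF assms(1)] bnd_sbound[OF assms(2)] by (auto simp: bnd_def)
  have zero: "mmul N (A i) (B (k - i)) = 0" if "i \<notin> ?I \<or> i \<notin> I" for i
    using *[of i] assms(4)[of i] that by auto
  have "Defs.smult N A B k = (\<Sum>i\<in>?I \<union> I. mmul N (A i) (B (k - i)))"
    unfolding Defs.smult_def using assms(3) zero
    by (intro sum.mono_neutral_left) blast+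
  also have "\<dots> = (\<Sum>i\<in>I. mmul N (A i) (B (k - i)))"
    using assms(3) zero by (intro sum.mono_neutral_right) blast+
  finally show ?thesis .
qed

lemma smult_eq:
  assumes "bnd a A" "bnd b B"
  shows "Defs.smult N A B k = (\<Sum>i\<in>{k - b..a}. mmul N (A i) (B (k - i)))"
  using assms by (intro smult_eq_sum) (auto simp: bnd_def)

lemma bnd_smult: "bnd a A \<Longrightarrow> bnd b B \<Longrightarrow> bnd (a + b) (Defs.smult N A B)"
  unfolding bnd_def[of "a + b"] by (auto simp: smult_eq)

lemma wfs_smult [simp]: "wfs N (Defs.smult N A B)"
  by (simp add: wfs_def Defs.smult_def)

lemma sbounded_smult [simp]: "sbounded A \<Longrightarrow> sbounded B \<Longrightarrow> sbounded (Defs.smult N A B)"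
  unfolding sbounded_iff using bnd_smult by blast

lemma sbounded_diff [simp]: "sbounded A \<Longrightarrow> sbounded B \<Longrightarrow> sbounded (A - B)"
proof -
  assume "sbounded A" "sbounded B"
  then obtain a b where "bnd a A" "bnd b B" by (auto simp: sbounded_iff)
  then have "bnd (max a b) (A - B)" by (auto simp: bnd_def)
  then show ?thesis by (auto simp: sbounded_iff)
qed

lemma smult_diff_left:
  assumes "sbounded A" "sbounded B" "sbounded C"
  shows "Defs.smult N (A - B) C = Defs.smult N A C - Defs.smult N B C"
proof
  fix k
  obtain a b c where bd: "bnd a A" "bnd b B" "bnd c C"
    using assms by (auto simp: sbounded_iff)
  then have "bnd (max a b) A" "bnd (max a b) B" "bnd (max a b) (A - B)"
    by (auto simp: bnd_def)
  with bd(3) show "Defs.smult N (A - B) C k = (Defs.smult N A C - Defs.smult N B C) k"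
    by (simp add: smult_eq[where a = "max a b" and b = c] mmul_diff_left sum_subtractf)
qed

lemma smult_diff_right:
  assumes "sbounded A" "sbounded B" "sbounded C"
  shows "Defs.smult N C (A - B) = Defs.smult N C A - Defs.smult N C B"
proof
  fix k
  obtain a b c where bd: "bnd a A" "bnd b B" "bnd c C"
    using assms by (auto simp: sbounded_iff)
  then have "bnd (max a b) A" "bnd (max a b) B" "bnd (max a b) (A - B)"
    by (auto simp: bnd_def)
  with bd(3) show "Defs.smult N C (A - B) k = (Defs.smult N C A - Defs.smult N C B) k"
    by (simp add: smult_eq[where b = "max a b" and a = c] mmul_diff_right sum_subtractf)
qed

lemma smult_assoc:
  assumes "sbounded A" "sbounded B" "sbounded C"
  shows "Defs.smult N (Defs.smult N A B) C = Defs.smult N A (Defs.smult N B C)"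
proof
  fix k
  obtain a b c where bd: "bnd a A" "bnd b B" "bnd c C"
    using assms by (auto simp: sbounded_iff)
  \<comment> \<open>The ranges of \<open>l\<close> and \<open>i\<close> contain all nonzero triple
    products and do not depend on each other, so the two sums can be swapped.\<close>
  let ?L = "{k - b - c..a}" and ?I = "{k - c..a + b}"
  have "Defs.smult N (Defs.smult N A B) C k
      = (\<Sum>i\<in>?I. mmul N (Defs.smult N A B i) (C (k - i)))"
    using smult_eq[OF bnd_smult[OF bd(1,2)] bd(3)] .
  also have "\<dots> = (\<Sum>i\<in>?I. \<Sum>l\<in>?L. mmul N (mmul N (A l) (B (i - l))) (C (k - i)))"
  proof (rule sum.cong)
    fix i assume "i \<in> ?I"
    then have "Defs.smult N A B i = (\<Sum>l\<in>?L. mmul N (A l) (B (i - l)))"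
      using bd by (intro smult_eq_sum) (auto simp: bnd_def)
    then show "mmul N (Defs.smult N A B i) (C (k - i))
        = (\<Sum>l\<in>?L. mmul N (mmul N (A l) (B (i - l))) (C (k - i)))"
      by (simp add: mmul_sum_left)
  qed simp
  also have "\<dots> = (\<Sum>l\<in>?L. \<Sum>i\<in>?I. mmul N (A l) (mmul N (B (i - l)) (C (k - i))))"
    unfolding mmul_assoc by (rule sum.swap)
  also have "\<dots> = (\<Sum>l\<in>?L. mmul N (A l) (Defs.smult N B C (k - l)))"
  proof (rule sum.cong)
    fix l assume l: "l \<in> ?L"
    have "Defs.smult N B C (k - l) = (\<Sum>r\<in>{k - c - l..a + b - l}. mmul N (B r) (C (k - l - r)))"
      using bd l by (intro smult_eq_sum) (auto simp: bnd_def)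
    also have "\<dots> = (\<Sum>i\<in>?I. mmul N (B (i - l)) (C (k - i)))"
      by (rule sum.reindex_bij_witness[where i = "\<lambda>i. i - l" and j = "\<lambda>r. r + l"])
        (auto simp: algebra_simps)
    finally show "(\<Sum>i\<in>?I. mmul N (A l) (mmul N (B (i - l)) (C (k - i))))
        = mmul N (A l) (Defs.smult N B C (k - l))"
      by (simp add: mmul_sum_right)
  qed simp
  also have "\<dots> = Defs.smult N A (Defs.smult N B C) k"
    using smult_eq[OF bd(1) bnd_smult[OF bd(2,3)], where N = N and k = k] by (simp add: algebra_simps)
  finally show "Defs.smult N (Defs.smult N A B) C k = Defs.smult N A (Defs.smult N B C) k" .
qed

text \<open>The common form of the connection \<open>J + q\<close> and of the cleared simple factor;
  multiplying by it involves two coefficients only, whatever the bounds.\<close>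

definition lin :: "cmat \<Rightarrow> cmat \<Rightarrow> cser" where
  "lin A0 A1 = (\<lambda>k. if k = 0 then A0 else if k = 1 then A1 else 0)"

lemma bnd_lin: "bnd 1 (lin A0 A1)"
  by (simp add: bnd_def lin_def)

lemma sbounded_lin [simp]: "sbounded (lin A0 A1)"
  using bnd_lin sbounded_iff by blast

lemma lin_smult:
  assumes "sbounded A"
  shows "Defs.smult N (lin B0 B1) A k = mmul N B0 (A k) + mmul N B1 (A (k - 1))"
proof -
  obtain a where "bnd a A" using assms by (auto simp: sbounded_iff)
  then have "Defs.smult N (lin B0 B1) A k = (\<Sum>i\<in>{0, 1}. mmul N (lin B0 B1 i) (A (k - i)))"
    by (intro smult_eq_sum[OF bnd_lin]) (auto simp: lin_def)
  then show ?thesis by (simp add: lin_def)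
qed

lemma smult_lin:
  assumes "sbounded A"
  shows "Defs.smult N A (lin B0 B1) k = mmul N (A k) B0 + mmul N (A (k - 1)) B1"
proof -
  obtain a where "bnd a A" using assms by (auto simp: sbounded_iff)
  then have "Defs.smult N A (lin B0 B1) k = (\<Sum>i\<in>{k, k - 1}. mmul N (A i) (lin B0 B1 (k - i)))"
    by (intro smult_eq_sum[OF _ bnd_lin]) (auto simp: lin_def)
  then show ?thesis by (simp add: lin_def)
qed

lemma sone_lin: "sone N = lin (idm N) 0"
  by (auto simp: sone_def lin_def)

lemma sbounded_sone [simp]: "sbounded (sone N)"
  by (simp add: sone_lin)

lemma smult_sone_right: "sbounded A \<Longrightarrow> wfs N A \<Longrightarrow> Defs.smult N A (sone N) = A"
  and smult_sone_left: "sbounded A \<Longrightarrow> wfs N A \<Longrightarrow> Defs.smult N (sone N) A = A"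
  by (auto simp: sone_lin smult_lin lin_smult wfs_def)

lemma bnd_spow: "bnd 1 A \<Longrightarrow> bnd (int p) (spow N A p)"
proof (induction p)
  case 0
  then show ?case by (simp add: bnd_def sone_def)
next
  case (Suc p)
  then show ?case using bnd_smult[of 1 A "int p" "spow N A p" N] by simp
qed

lemma sbounded_spow [simp]: "sbounded A \<Longrightarrow> sbounded (spow N A p)"
  by (induction p) simp_all

lemma wfs_spow [simp]: "wfs N (spow N A p)"
  by (cases p) (simp_all add: wfs_def sone_def Defs.smult_def)

lemma pos_eval_eq:
  assumes "bnd (int d) A"
  shows "pos_eval A z = (\<Sum>i\<le>d. smul (z ^ i) (A (int i)))"
proof -
  have *: "A (int i) = 0" if "i > d \<or> i > nat (sbound A)" for i
    using that assms bnd_sbound[OF assms] by (auto simp: bnd_def)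
  have "pos_eval A z = (\<Sum>i\<in>{..nat (sbound A)} \<union> {..d}. smul (z ^ i) (A (int i)))"
    unfolding pos_eval_def by (rule sum.mono_neutral_left) (auto simp: *)
  also have "\<dots> = (\<Sum>i\<le>d. smul (z ^ i) (A (int i)))"
    by (rule sum.mono_neutral_right) (auto simp: *)
  finally show ?thesis .
qed

subsection \<open>The simple factor as a series\<close>

text \<open>The expansion of \<open>kmat\<close> at infinity; as for \<open>kmat\<close> itself, the inverse is obtained
  by changing the sign of \<open>a\<close>.\<close>
definition kser :: "nat \<Rightarrow> complex \<Rightarrow> cmat \<Rightarrow> cser" where
  "kser N a P = (\<lambda>i. if i > 0 then 0 else if i = 0 then idm N
      else smul (2 * a ^ nat (- i)) (idm N - P))"

lemma bnd_kser: "bnd 0 (kser N a P)"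
  by (simp add: bnd_def kser_def)

lemma sbounded_kser [simp]: "sbounded (kser N a P)"
  using bnd_kser sbounded_iff by blast

lemma wfs_kser [simp]: "wfm N P \<Longrightarrow> wfs N (kser N a P)"
  by (simp add: wfs_def kser_def)

lemma nat_minus_shift: "(k::int) < 0 \<Longrightarrow> nat (1 - k) = Suc (nat (- k))"
  by simp

text \<open>Below index 0 the geometric coefficients telescope, and at index 0 the sum
  \<open>- a + 2 a (1 - P)\<close> is \<open>- T\<close>.\<close>

lemma clear_kser:
  assumes "wfm N P"
  shows "Defs.smult N (lin (smul (- a) (idm N)) (idm N)) (kser N a P) = lin (- Tmat N a P) (idm N)"
proof
  fix k :: int
  consider "k > 1" | "k = 1" | "k = 0" | "k < 0" by linarith
  then show "Defs.smult N (lin (smul (- a) (idm N)) (idm N)) (kser N a P) k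
      = lin (- Tmat N a P) (idm N) k"
    using assms unfolding lin_smult[OF sbounded_kser]
    by cases (simp_all add: kser_def lin_def Tmat_def mmul_distribs nat_minus_shift,
      simp_all add: fun_eq_iff smul_def algebra_simps)
qed

text \<open>On the range of \<open>P\<close> the left side is \<open>(lambda - a) * 1\<close>; on
  the kernel \<open>lambda + a\<close> clears the pole of the second factor and again leaves
  \<open>lambda - a\<close>.\<close>

lemma Tmat_kser:
  assumes "wfm N P" "mmul N P P = P"
  shows "Defs.smult N (lin (- Tmat N a P) (idm N)) (kser N (- a) P) = lin (smul (- a) (idm N)) (idm N)"
proof
  fix k :: int
  consider "k > 1" | "k = 1" | "k = 0" | "k < 0" by linarith
  then show "Defs.smult N (lin (- Tmat N a P) (idm N)) (kser N (- a) P) k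
      = lin (smul (- a) (idm N)) (idm N) k"
    using assms unfolding lin_smult[OF sbounded_kser]
    by cases (simp_all add: kser_def lin_def Tmat_def mmul_distribs nat_minus_shift,
      simp_all add: fun_eq_iff smul_def algebra_simps)
qed

text \<open>The equation is the downward recursion \<open>X (k - 1) = - a X k\<close>, and a series
  bounded above starts it with 0.\<close>

lemma scalar_lin_cancel:
  assumes "sbounded X" "wfs N X"
    and "Defs.smult N (lin (smul a (idm N)) (idm N)) X = 0"
  shows "X = 0"
proof -
  obtain d where d: "bnd d X" using assms(1) by (auto simp: sbounded_iff)
  have step: "X (k - 1) = - smul a (X k)" for k
    using fun_cong[OF assms(3), of k] assms(1,2)
    by (simp add: lin_smult wfs_def mmul_distribs eq_neg_iff_add_eq_0 add.commute)
  have "X (d + 1 - int p) = 0" for p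
  proof (induction p)
    case 0
    then show ?case using d by (simp add: bnd_def)
  next
    case (Suc p)
    have "X (d + 1 - int p - 1) = 0" unfolding step Suc by simp
    then show ?case by (simp add: algebra_simps)
  qed
  then have "X k = 0" if "k \<le> d" for k
    using that spec[of "\<lambda>p. X (d + 1 - int p) = 0" "nat (d + 1 - k)"] by simp
  then have "X k = 0" for k
    using d by (cases "k > d") (auto simp: bnd_def)
  then show ?thesis by auto
qed

lemma scalar_lin_commute:
  assumes "sbounded X" "wfs N X"
  shows "Defs.smult N (lin (smul a (idm N)) (idm N)) X = Defs.smult N X (lin (smul a (idm N)) (idm N))"
  using assms by (auto simp: lin_smult smult_lin wfs_def mmul_distribs)

text \<open>No product of two infinite series is expanded: multiplied by \<open>lambda - a\<close>,
  the first factor becomes \<open>lambda - T\<close>, which \<open>Tmat_kser\<close> handles, and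
  \<open>lambda - a\<close> is then cancelled.\<close>

lemma kser_inverse:
  assumes "wfm N P" "mmul N P P = P"
  shows "Defs.smult N (kser N a P) (kser N (- a) P) = sone N"
proof -
  let ?z = "lin (smul (- a) (idm N)) (idm N)"
  have "Defs.smult N ?z (Defs.smult N (kser N a P) (kser N (- a) P)) = ?z"
    using assms by (simp add: smult_assoc[symmetric] clear_kser Tmat_kser)
  also have "\<dots> = Defs.smult N ?z (sone N)"
    by (subst smult_sone_right) (simp_all add: wfs_def, simp_all add: lin_def)
  finally have "Defs.smult N ?z (Defs.smult N (kser N a P) (kser N (- a) P) - sone N) = 0"
    by (simp add: smult_diff_right)
  then have "Defs.smult N (kser N a P) (kser N (- a) P) - sone N = 0"
  proof (rule scalar_lin_cancel[rotated 2])
    show "wfs N (Defs.smult N (kser N a P) (kser N (- a) P) - sone N)"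
      using wfs_smult by (auto simp: wfs_def sone_def)
  qed simp
  then show ?thesis by simp
qed

subsection \<open>The reality condition for series\<close>

text \<open>The adjoint of \<open>A (- lambda)\<close>; the group condition becomes
  \<open>g * sadj g = 1\<close>.\<close>

definition sadj :: "nat \<Rightarrow> nat \<Rightarrow> cser \<Rightarrow> cser" where
  "sadj m n A = (\<lambda>k. adj m n (sneg A k))"

lemma bnd_sadj: "bnd d A \<Longrightarrow> bnd d (sadj m n A)"
  by (simp add: bnd_def sadj_def sneg_def adj_simps)

lemma sbounded_sadj [simp]: "sbounded A \<Longrightarrow> sbounded (sadj m n A)"
  using bnd_sadj sbounded_iff by blast

lemma wfs_sadj [simp]: "wfs (Nd m n) (sadj m n A)"
  by (simp add: wfs_def sadj_def)

lemma sadj_smult: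
  assumes "sbounded A" "sbounded B"
  shows "sadj m n (Defs.smult (Nd m n) A B) = Defs.smult (Nd m n) (sadj m n B) (sadj m n A)"
proof
  fix k
  let ?N = "Nd m n"
  obtain a b where bd: "bnd a A" "bnd b B"
    using assms by (auto simp: sbounded_iff)
  have sgn: "sneg X i = smul (if even i then 1 else - 1) (X i)" for X i
    by (auto simp: sneg_def smul_def fun_eq_iff)
  have "sadj m n (Defs.smult ?N A B) k
      = (\<Sum>i\<in>{k - b..a}. mmul ?N (sadj m n B (k - i)) (sadj m n A i))"
    unfolding sadj_def sgn smult_eq[OF bd] smul_sum adj_sum
    by (rule sum.cong) (auto simp: adj_simps adj_mmul mmul_distribs)
  also have "\<dots> = (\<Sum>i\<in>{k - a..b}. mmul ?N (sadj m n B i) (sadj m n A (k - i)))"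
    by (rule sum.reindex_bij_witness[where i = "\<lambda>i. k - i" and j = "\<lambda>i. k - i"]) auto
  also have "\<dots> = Defs.smult ?N (sadj m n B) (sadj m n A) k"
    using smult_eq[OF bnd_sadj bnd_sadj, OF bd(2,1)] by metis
  finally show "sadj m n (Defs.smult ?N A B) k = Defs.smult ?N (sadj m n B) (sadj m n A) k" .
qed

lemma grp_minus_iff:
  "grp_minus m n g \<longleftrightarrow> g 0 = idm (Nd m n) \<and> bnd 0 g \<and> wfs (Nd m n) g
     \<and> Defs.smult (Nd m n) g (sadj m n g) = sone (Nd m n)"
  by (simp add: grp_minus_def bnd_def wfs_def sadj_def adj_eq minv_Cmn mmul_assoc)

text \<open>Replacing \<open>lambda\<close> by \<open>- lambda\<close> in
  \<open>2 a / (lambda - a)\<close> gives \<open>- 2 a / (lambda + a)\<close>, and \<open>P\<close>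
  is self-adjoint. Together with \<open>kser_inverse\<close> this puts the simple factor into the
  group.\<close>

lemma sadj_kser:
  assumes "Oproj m n P"
  shows "sadj m n (kser (Nd m n) a P) = kser (Nd m n) (- a) P"
proof
  fix k :: int
  have *: "(- a) ^ nat (- k) = (if even k then 1 else - 1) * a ^ nat (- k)" if "k < 0"
    using that by (subst power_minus) (simp add: minus_one_power_iff even_nat_iff)
  show "sadj m n (kser (Nd m n) a P) k = kser (Nd m n) (- a) P k"
    using assms *
    by (auto simp: sadj_def sneg_def kser_def adj_simps Oproj_def) (auto simp: smul_def fun_eq_iff)
qed

lemma grp_minus_kser:
  assumes "Oproj m n P" "grp_minus m n g"
  shows "grp_minus m n (Defs.smult (Nd m n) (kser (Nd m n) a P) g)"
proof -
  let ?N = "Nd m n" and ?k = "kser (Nd m n) a P"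
  have P: "wfm ?N P" "mmul ?N P P = P" using assms(1) by (auto simp: Oproj_def)
  have g: "g 0 = idm ?N" "bnd 0 g" "wfs ?N g" "Defs.smult ?N g (sadj m n g) = sone ?N"
    using assms(2) by (auto simp: grp_minus_iff)
  have sg [simp]: "sbounded g" using g by (auto simp: sbounded_iff)
  have "Defs.smult ?N g (Defs.smult ?N (sadj m n g) X) = X" if "sbounded X" "wfs ?N X" for X
    using that by (simp add: smult_assoc[symmetric] g smult_sone_left)
  then have "Defs.smult ?N (Defs.smult ?N ?k g) (sadj m n (Defs.smult ?N ?k g)) = sone ?N"
    using P assms(1) by (simp add: sadj_smult sadj_kser smult_assoc kser_inverse)
  moreover have "Defs.smult ?N ?k g 0 = idm ?N"
    unfolding smult_eq[OF bnd_kser g(2)] by (simp add: g kser_def)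
  moreover have "bnd 0 (Defs.smult ?N ?k g)"
    using bnd_smult[OF bnd_kser g(2)] by simp
  ultimately show ?thesis by (simp add: grp_minus_iff)
qed

subsection \<open>Lax equations\<close>

text \<open>\<open>X' = X A - B X\<close>, with different connections on the two sides: for
  \<open>A = B\<close> this is the equation of \<open>S\<close>, otherwise the gauge equation of a
  dressing factor.\<close>

definition lax :: "nat \<Rightarrow> (real \<Rightarrow> cser) \<Rightarrow> cser \<Rightarrow> cser \<Rightarrow> real \<Rightarrow> bool" where
  "lax N X A B x \<longleftrightarrow>
    (\<forall>i. has_mderiv (\<lambda>y. X y i) ((Defs.smult N (X x) A - Defs.smult N B (X x)) i) x)"

text \<open>By degrees alone the right side could reach one power higher; there the coefficients of
  \<open>X\<close> vanish identically, hence so do their derivatives.\<close>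

lemma lax_bnd:
  assumes "lax N X A B x" "\<And>y. bnd a (X y)"
  shows "bnd a (Defs.smult N (X x) A - Defs.smult N B (X x))"
  unfolding bnd_def
proof (intro allI impI)
  fix i assume "a < i"
  then have "(\<lambda>y. X y i) = (\<lambda>y. 0)" using assms(2) by (auto simp: bnd_def)
  then have "has_mderiv (\<lambda>y. 0) ((Defs.smult N (X x) A - Defs.smult N B (X x)) i) x"
    using assms(1) unfolding lax_def by metis
  then show "(Defs.smult N (X x) A - Defs.smult N B (X x)) i = 0"
    using has_mderiv_unique has_mderiv_const by blast
qed

text \<open>In the Leibniz rule \<open>(X A - B X) Y + X (Y C - A Y)\<close> the intermediate
  connection \<open>A\<close> cancels.\<close>

lemma lax_smult:
  assumes X: "\<And>y. bnd a (X y)" and Y: "\<And>y. bnd b (Y y)"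
    and sb: "sbounded A" "sbounded B" "sbounded C"
    and lax: "lax N X A B x" "lax N Y C A x"
  shows "lax N (\<lambda>y. Defs.smult N (X y) (Y y)) C B x"
  unfolding lax_def
proof
  fix i
  let ?X' = "Defs.smult N (X x) A - Defs.smult N B (X x)"
  let ?Y' = "Defs.smult N (Y x) C - Defs.smult N A (Y x)"
  note bX' = lax_bnd[OF lax(1) X] and bY' = lax_bnd[OF lax(2) Y]
  have sX [simp]: "sbounded (X x)" "sbounded (Y x)" using X Y by (auto simp: sbounded_iff)
  have "has_mderiv (\<lambda>y. \<Sum>l\<in>{i - b..a}. mmul N (X y l) (Y y (i - l)))
      (\<Sum>l\<in>{i - b..a}. mmul N (?X' l) (Y x (i - l)) + mmul N (X x l) (?Y' (i - l))) x"
    using lax unfolding lax_def by (intro has_mderiv_sum has_mderiv_mmul) blast+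
  moreover have "(\<Sum>l\<in>{i - b..a}. mmul N (?X' l) (Y x (i - l)) + mmul N (X x l) (?Y' (i - l)))
      = (Defs.smult N ?X' (Y x) + Defs.smult N (X x) ?Y') i"
    unfolding plus_fun_apply[of "Defs.smult N ?X' (Y x)" "Defs.smult N (X x) ?Y'" i]
      smult_eq[OF bX' Y] smult_eq[OF X bY'] by (rule sum.distrib)
  moreover have "Defs.smult N ?X' (Y x) + Defs.smult N (X x) ?Y'
      = Defs.smult N (Defs.smult N (X x) (Y x)) C - Defs.smult N B (Defs.smult N (X x) (Y x))"
    using sb by (simp add: smult_diff_left smult_diff_right smult_assoc)
  ultimately show "has_mderiv (\<lambda>y. Defs.smult N (X y) (Y y) i)
      ((Defs.smult N (Defs.smult N (X x) (Y x)) C - Defs.smult N B (Defs.smult N (X x) (Y x))) i) x"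
    unfolding smult_eq[OF X Y] by simp
qed

lemma lax_spow:
  assumes S: "\<And>y. bnd 1 (S y)" and A: "sbounded A" "wfs N A" and lax: "lax N S A A x"
  shows "lax N (\<lambda>y. spow N (S y) p) A A x"
proof (induction p)
  case 0
  show ?case
    unfolding lax_def using A by (simp add: smult_sone_left smult_sone_right has_mderiv_const)
next
  case (Suc p)
  have "lax N (\<lambda>y. Defs.smult N (S y) (spow N (S y) p)) A A x"
    using lax_smult[OF S bnd_spow[OF S] A(1) A(1) A(1) lax Suc] .
  then show ?case by simp
qed

text \<open>Every negative coefficient carries the same equation for \<open>D\<close>, up to a
  scalar. Index 0 forces \<open>v = u + 2 a [e, P]\<close>, the origin of the Darboux formula, and
  at index 1 the two terms \<open>e\<close> cancel.\<close>

lemma lax_kser: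
  assumes wf: "wfm N e" "wfm N u" "wfm N v" "wfm N (P x)"
    and P: "has_mderiv P D x"
    and D: "D = mmul N (v + smul a e) (idm N - P x) - mmul N (idm N - P x) (u + smul a e)"
    and v: "v = u + smul (2 * a) (brk N e (P x))"
  shows "lax N (\<lambda>y. kser N a (P y)) (lin u e) (lin v e) x"
  unfolding lax_def
proof
  fix i :: int
  let ?c = "(Defs.smult N (kser N a (P x)) (lin u e) - Defs.smult N (lin v e) (kser N a (P x))) i"
  have c: "?c = mmul N (kser N a (P x) i) u + mmul N (kser N a (P x) (i - 1)) e
      - (mmul N v (kser N a (P x) i) + mmul N e (kser N a (P x) (i - 1)))"
    by (simp add: lin_smult smult_lin)
  show "has_mderiv (\<lambda>y. kser N a (P y) i) ?c x"
  proof (cases "i < 0")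
    case True
    have "has_mderiv (\<lambda>y. smul (2 * a ^ nat (- i)) (idm N - P y)) (smul (2 * a ^ nat (- i)) (0 - D)) x"
      by (intro has_mderiv_smul has_mderiv_diff has_mderiv_const P)
    moreover have "?c = smul (2 * a ^ nat (- i)) (0 - D)"
      unfolding c D using True
      by (simp add: kser_def nat_minus_shift mmul_distribs) (simp add: fun_eq_iff smul_def algebra_simps)
    ultimately show ?thesis using True by (simp add: kser_def)
  next
    case False
    then consider "i > 1" | "i = 1" | "i = 0" by linarith
    then have "?c = 0"
    proof cases
      case 3
      then show ?thesis unfolding c using wf
        by (simp add: kser_def v brk_def mmul_distribs)
    qed (unfold c, use wf in \<open>simp_all add: kser_def\<close>)
    moreover have "(\<lambda>y. kser N a (P y) i) = (\<lambda>y. if i > 0 then 0 else idm N)"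
      using False by (auto simp: kser_def)
    ultimately show ?thesis by (simp only: has_mderiv_const)
  qed
qed

text \<open>Summing the coefficients of \<open>Q' (z - T) = (z - T) Q\<close> over the nonnegative powers leaves
  only the boundary terms of index \<open>- 1\<close>.\<close>
lemma pos_eval_intertwine:
  assumes Q: "bnd (int d) Q" "bnd (int d) Q'" "wfs N Q" "wfs N Q'"
    and eq: "Defs.smult N Q' (lin (- T) (idm N)) = Defs.smult N (lin (- T) (idm N)) Q"
  shows "mmul N (pos_eval Q' z) (smul z (idm N) - T)
    = mmul N (smul z (idm N) - T) (pos_eval Q z) + (Q (- 1) - Q' (- 1))"
proof -
  have sb: "sbounded Q" "sbounded Q'" using Q by (auto simp: sbounded_iff)
  \<comment> \<open>One summand more than the degree, since the index is lowered by one; its term at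
    \<open>i = 0\<close> is the coefficient of index \<open>- 1\<close>.\<close>
  have shift: "(\<Sum>i\<le>Suc d. smul (z ^ i) (X (int i - 1))) = X (- 1) + smul z (pos_eval X z)"
    if "bnd (int d) X" for X
    unfolding pos_eval_eq[OF that]
    by (subst sum.atMost_Suc_shift) (simp add: smul_sum smul_smul)
  have coeff: "Q' (k - 1) - mmul N (Q' k) T = Q (k - 1) - mmul N T (Q k)" for k
    using fun_cong[OF eq, of k] Q(3,4) sb
    by (simp add: lin_smult smult_lin wfs_def mmul_distribs)
  have up: "bnd (int (Suc d)) Q" "bnd (int (Suc d)) Q'"
    using Q(1,2) by (auto intro: bnd_mono)
  have wf: "wfm N (pos_eval Q z)" "wfm N (pos_eval Q' z)"
    using Q by (simp_all add: pos_eval_def wfs_def)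
  have "(\<Sum>i\<le>Suc d. smul (z ^ i) (Q' (int i - 1) - mmul N (Q' (int i)) T))
      = Q' (- 1) + smul z (pos_eval Q' z) - mmul N (pos_eval Q' z) T"
    unfolding smul_diff sum_subtractf shift[OF Q(2)] pos_eval_eq[OF up(2)]
    by (simp only: mmul_sum_left mmul_smul_left)
  moreover have "(\<Sum>i\<le>Suc d. smul (z ^ i) (Q (int i - 1) - mmul N T (Q (int i))))
      = Q (- 1) + smul z (pos_eval Q z) - mmul N T (pos_eval Q z)"
    unfolding smul_diff sum_subtractf shift[OF Q(1)] pos_eval_eq[OF up(1)]
    by (simp only: mmul_sum_right mmul_smul_right)
  ultimately have "Q' (- 1) + smul z (pos_eval Q' z) - mmul N (pos_eval Q' z) T
      = Q (- 1) + smul z (pos_eval Q z) - mmul N T (pos_eval Q z)"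
    unfolding coeff by simp
  then show ?thesis using wf by (simp add: mmul_distribs algebra_simps)
qed

text \<open>\<open>K\<close> is the same for all \<open>z\<close>. At \<open>z = a\<close> the left
  side is a multiple of \<open>W (1 - P)\<close>, killed by \<open>P\<close> from the right, which
  yields \<open>K P\<close>; at \<open>z = - a\<close> it is a multiple of \<open>W P\<close>, which
  yields \<open>K (1 - P)\<close>.\<close>

lemma intertwine_boundary:
  assumes P: "wfm N P" "mmul N P P = P" and K: "wfm N K"
    and eq: "\<And>z. mmul N (W z) (smul z (idm N) - Tmat N a P)
      = mmul N (smul z (idm N) - Tmat N a P) (V z) + K"
  shows "K = smul (2 * a) (mmul N P (mmul N (V (- a)) (idm N - P))
      - mmul N (idm N - P) (mmul N (V a) P))"
proof -
  have 1: "smul a (idm N) - Tmat N a P = smul (2 * a) (idm N - P)"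
    and 2: "smul (- a) (idm N) - Tmat N a P = smul (- (2 * a)) P"
    by (simp_all add: Tmat_def smul_def fun_eq_iff algebra_simps)
  have "mmul N (mmul N (W a) (smul (2 * a) (idm N - P))) P = 0"
    using P by (simp add: mmul_distribs)
  then have KP: "mmul N K P = - smul (2 * a) (mmul N (idm N - P) (mmul N (V a) P))"
    unfolding eq[of a, unfolded 1]
    by (simp add: mmul_add_left mmul_smul_left mmul_assoc eq_neg_iff_add_eq_0 add.commute)
  have "mmul N (mmul N (W (- a)) (smul (- (2 * a)) P)) (idm N - P) = 0"
    using P by (simp add: mmul_distribs)
  then have KQ: "mmul N K (idm N - P) = - smul (- (2 * a)) (mmul N P (mmul N (V (- a)) (idm N - P)))"
    unfolding eq[of "- a", unfolded 2]
    by (simp add: mmul_add_left mmul_smul_left mmul_assoc eq_neg_iff_add_eq_0 add.commute)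
  have "K = mmul N K P + mmul N K (idm N - P)"
    using K by (simp add: mmul_diff_right)
  also have "\<dots> = smul (2 * a) (mmul N P (mmul N (V (- a)) (idm N - P))
      - mmul N (idm N - P) (mmul N (V a) P))"
    unfolding KP KQ by (simp add: fun_eq_iff smul_def algebra_simps)
  finally show ?thesis .
qed

subsection \<open>Solutions of the flow\<close>

lemma wfm_emat [simp]: "wfm (Nd m n) (emat m n)"
  by (auto simp: wfm_def emat_def Em_def Nd_def)

lemma wfm_bmat [simp]: "wfm (Nd m n) (bmat m n)"
  unfolding bmat_def by (intro wfm_sum) (auto simp: wfm_def Em_def Nd_def)

lemma Jser_lin: "Jser m n = lin (bmat m n) (emat m n)"
  by (auto simp: Jser_def lin_def)

lemma Jser_add_lin:
  "(\<lambda>k. Jser m n k + (if k = 0 then u else 0)) = lin (bmat m n + u) (emat m n)"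
proof
  fix k :: int
  show "Jser m n k + (if k = 0 then u else 0) = lin (bmat m n + u) (emat m n) k"
    by (cases "k = 0") (simp_all add: Jser_def lin_def)
qed

text \<open>Since \<open>xi\<close> has negative powers only, the nonnegative part of
  \<open>[J, xi]\<close> can arise only from \<open>lambda e\<close> meeting index
  \<open>- 1\<close>.\<close>

lemma Ymem_iff:
  "Ymem m n u \<longleftrightarrow> (\<exists>xi. lie_minus m n xi \<and> u = brk (Nd m n) (emat m n) (xi (- 1)))"
proof -
  have *: "(\<forall>i\<ge>0. scomm (Nd m n) (Jser m n) xi i = (if i = 0 then u else 0)) \<longleftrightarrow>
      u = brk (Nd m n) (emat m n) (xi (- 1))" if "lie_minus m n xi" for xi
  proof -
    have nonneg: "xi i = 0" if "i \<ge> 0" for i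
      using \<open>lie_minus m n xi\<close> that by (simp add: lie_minus_def)
    then have "bnd 0 xi" by (simp add: bnd_def)
    then have "sbounded xi" by (auto simp: sbounded_iff)
    then have "scomm (Nd m n) (Jser m n) xi i
        = (if i = 0 then brk (Nd m n) (emat m n) (xi (- 1)) else 0)" if "i \<ge> 0" for i
      using that by (simp add: scomm_def Jser_lin lin_smult smult_lin nonneg brk_def)
    then show ?thesis by auto
  qed
  then show ?thesis unfolding Ymem_def by blast
qed

lemma wfm_brk [simp]: "wfm N (brk N A B)"
  by (simp add: brk_def)

lemma wfm_Ymem: "Ymem m n u \<Longrightarrow> wfm (Nd m n) u"
  by (auto simp: Ymem_iff)

text \<open>Only the coefficient of index \<open>- 1\<close> of an element of the negative subalgebra matters, and
  the projection is made traceless by a multiple of the identity.\<close>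
lemma Ymem_step:
  assumes "Ymem m n u" "Oproj m n P"
  shows "Ymem m n (u + smul c (brk (Nd m n) (emat m n) P))"
proof -
  let ?N = "Nd m n"
  obtain xi where xi: "lie_minus m n xi" "u = brk ?N (emat m n) (xi (- 1))"
    using assms(1) by (auto simp: Ymem_iff)
  define P0 where "P0 = P - smul (mtrace ?N P / of_nat ?N) (idm ?N)"
  define eta :: cser where "eta = (\<lambda>i. if i = - 1 then xi (- 1) + smul c P0 else 0)"
  have P: "wfm ?N P" "adj m n P = P" using assms(2) by (auto simp: Oproj_def)
  have P0: "wfm ?N P0" "adj m n P0 = P0"
    using P by (simp_all add: P0_def adj_simps)
  have "?N \<noteq> 0" by (simp add: Nd_def)
  then have "mtrace ?N P0 = 0"
    by (simp add: P0_def mtrace_def smul_def idm_def sum_subtractf)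
  then have tr: "mtrace ?N (xi (- 1) + smul c P0) = mtrace ?N (xi (- 1))"
    by (simp add: mtrace_def smul_def sum.distrib sum_distrib_left[symmetric])
  \<comment> \<open>At the odd index \<open>- 1\<close> the signs from \<open>sneg\<close> and
    \<open>sigma_star\<close> cancel, so this coefficient is self-adjoint, as a projection
    is.\<close>
  have "sigma_star m n (sneg xi (- 1)) = xi (- 1)"
    using xi(1) by (auto simp: lie_minus_def)
  then have "adj m n (xi (- 1)) = xi (- 1)"
    by (simp add: sigma_star_adj sneg_def adj_simps)
  then have "lie_minus m n eta"
    using xi(1) P0 tr
    by (auto simp: lie_minus_def eta_def sigma_star_adj sneg_def adj_simps mtrace_def)
  moreover have "u + smul c (brk ?N (emat m n) P) = brk ?N (emat m n) (eta (- 1))"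
    by (simp add: xi(2) eta_def P0_def brk_def mmul_distribs)
  ultimately show ?thesis by (auto simp: Ymem_iff)
qed

text \<open>\<open>S = g J g^{-1}\<close>, where the reality condition gives
  \<open>g^{-1} = sadj g\<close>, again of degree at most 0.\<close>

lemma bnd_dressed:
  assumes "grp_minus m n g" "sbounded S" "wfs (Nd m n) S"
    and "Defs.smult (Nd m n) S g = Defs.smult (Nd m n) g (Jser m n)"
  shows "bnd 1 S"
proof -
  let ?N = "Nd m n"
  have g: "bnd 0 g" "Defs.smult ?N g (sadj m n g) = sone ?N"
    using assms(1) by (auto simp: grp_minus_iff)
  have sg [simp]: "sbounded g" using g by (auto simp: sbounded_iff)
  have "S = Defs.smult ?N (Defs.smult ?N S g) (sadj m n g)"
    using assms(2,3) by (simp add: smult_assoc g smult_sone_right)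
  then have "S = Defs.smult ?N (Defs.smult ?N g (Jser m n)) (sadj m n g)"
    by (simp only: assms(4))
  moreover have "bnd 1 (Defs.smult ?N (Defs.smult ?N g (Jser m n)) (sadj m n g))"
    unfolding Jser_lin
    using bnd_smult[OF bnd_smult[OF g(1) bnd_lin] bnd_sadj[OF g(1)]] by simp
  ultimately show ?thesis by simp
qed

lemma Scond_iff:
  "Scond m n q S \<longleftrightarrow> (\<forall>x t. sbounded (S x t) \<and> wfs (Nd m n) (S x t)
      \<and> (\<exists>g. grp_minus m n g \<and>
            Defs.smult (Nd m n) (S x t) g = Defs.smult (Nd m n) g (Jser m n))
      \<and> lax (Nd m n) (\<lambda>y. S y t) (lin (bmat m n + q x t) (emat m n))
            (lin (bmat m n + q x t) (emat m n)) x)"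
  (is "?L \<longleftrightarrow> ?R")
proof -
  define c where "c x t i = scomm (Nd m n) (lin (bmat m n + q x t) (emat m n)) (S x t) i" for x t i
  have lax_c: "lax (Nd m n) (\<lambda>y. S y t) (lin (bmat m n + q x t) (emat m n))
            (lin (bmat m n + q x t) (emat m n)) x \<longleftrightarrow>
      (\<forall>i. has_mderiv (\<lambda>y. S y t i) (- c x t i) x)" for x t
    by (simp add: lax_def c_def scomm_def)
  have "(\<forall>i. diffx (\<lambda>x t. S x t i)) \<and> (\<forall>x t i. pdx (\<lambda>x t. S x t i) x t + c x t i = 0) \<longleftrightarrow>
      (\<forall>x t i. has_mderiv (\<lambda>y. S y t i) (- c x t i) x)" (is "?A \<longleftrightarrow> ?B")
  proof
    assume A: ?A
    show ?B
    proof (intro allI)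
      fix x t i
      have "pdx (\<lambda>x t. S x t i) x t = - c x t i"
        using A by (simp add: eq_neg_iff_add_eq_0)
      then show "has_mderiv (\<lambda>y. S y t i) (- c x t i) x"
        using diffxD[of "\<lambda>x t. S x t i" t x] A by simp
    qed
  next
    assume ?B
    then have "diffx (\<lambda>x t. S x t i)" "pdx (\<lambda>x t. S x t i) = (\<lambda>x t. - c x t i)" for i
      using diffx_pdxI[of "\<lambda>x t. S x t i" "\<lambda>x t. - c x t i"] by blast+
    then show ?A by simp
  qed
  then show ?thesis
    unfolding Scond_def Jser_add_lin lax_c wfs_def c_def[symmetric] by blast
qed

lemma lax_zero_coeff:
  assumes "lax N Q (lin u e) (lin u e) x" "sbounded (Q x)"
  shows "has_mderiv (\<lambda>y. Q y 0) (- brk N u (Q x 0) - brk N e (Q x (- 1))) x"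
proof -
  have "has_mderiv (\<lambda>y. Q y 0)
      ((Defs.smult N (Q x) (lin u e) - Defs.smult N (lin u e) (Q x)) 0) x"
    using assms(1) unfolding lax_def by blast
  moreover have "(Defs.smult N (Q x) (lin u e) - Defs.smult N (lin u e) (Q x)) 0
      = - brk N u (Q x 0) - brk N e (Q x (- 1))"
    unfolding minus_apply lin_smult[OF assms(2)] smult_lin[OF assms(2)]
    by (simp add: brk_def mmul_distribs fun_eq_iff)
  ultimately show ?thesis by simp
qed

text \<open>By the Lax equation, the flow is \<open>q_t = - [e, (S^(2j-1))_(-1)]\<close>.\<close>
lemma flow_eq_iff:
  assumes "Scond m n q S" "\<And>x t. wfm (Nd m n) (q x t)"
  shows "flow_eq m n j q S \<longleftrightarrow> (\<forall>x t. has_mderiv (\<lambda>s. q x s)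
    (- brk (Nd m n) (emat m n) (spow (Nd m n) (S x t) (2 * j - 1) (- 1))) t)"
proof -
  let ?N = "Nd m n"
  define Q where "Q x t = spow ?N (S x t) (2 * j - 1)" for x t
  define D where "D x t = - brk ?N (bmat m n + q x t) (Q x t 0) - brk ?N (emat m n) (Q x t (- 1))"
    for x t
  have S: "bnd 1 (S x t)" "lax ?N (\<lambda>y. S y t) (lin (bmat m n + q x t) (emat m n))
            (lin (bmat m n + q x t) (emat m n)) x" for x t
    using assms(1) bnd_dressed unfolding Scond_iff by blast+
  have sb: "sbounded (S x t)" for x t using S by (auto simp: sbounded_iff)
  have "wfs ?N (lin (bmat m n + q x t) (emat m n))" for x t
    using assms(2) by (simp add: wfs_def lin_def)
  then have "has_mderiv (\<lambda>y. Q y t 0) (D x t) x" for x t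
    unfolding Q_def D_def
    using lax_zero_coeff[OF lax_spow[OF S(1) sbounded_lin _ S(2)]] sb by simp
  then have dx: "diffx (\<lambda>x t. Q x t 0)" and px: "pdx (\<lambda>x t. Q x t 0) = D"
    by (rule diffx_pdxI)+
  have "pdx (\<lambda>x t. Q x t 0) x t + brk ?N (bmat m n + q x t) (Q x t 0)
      = - brk ?N (emat m n) (Q x t (- 1))" for x t
    unfolding px D_def by simp
  then have "flow_eq m n j q S \<longleftrightarrow>
      difft q \<and> (\<forall>x t. pdt q x t = - brk ?N (emat m n) (Q x t (- 1)))"
    unfolding flow_eq_def Q_def[symmetric] using dx by simp
  also have "\<dots> \<longleftrightarrow> (\<forall>x t. has_mderiv (\<lambda>s. q x s) (- brk ?N (emat m n) (Q x t (- 1))) t)"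
  proof safe
    fix x t
    assume "difft q" and eq: "\<forall>x t. pdt q x t = - brk ?N (emat m n) (Q x t (- 1))"
    from difftD[OF this(1), of x t]
    show "has_mderiv (\<lambda>s. q x s) (- brk ?N (emat m n) (Q x t (- 1))) t"
      unfolding eq[rule_format] .
  next
    assume *: "\<forall>x t. has_mderiv (\<lambda>s. q x s) (- brk ?N (emat m n) (Q x t (- 1))) t"
    show "difft q" by (rule difft_pdtI) (use * in blast)
    have "pdt q = (\<lambda>x t. - brk ?N (emat m n) (Q x t (- 1)))"
      by (rule difft_pdtI) (use * in blast)
    then show "pdt q x t = - brk ?N (emat m n) (Q x t (- 1))" for x t by simp
  qed
  finally show ?thesis unfolding Q_def .
qed

subsection \<open>The Darboux step\<close>

text \<open>\<open>flow_sol\<close> with its series exposed, because the time connection has to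
  refer to that same series.\<close>

definition solution :: "nat \<Rightarrow> nat \<Rightarrow> nat \<Rightarrow> (real \<Rightarrow> real \<Rightarrow> cmat) \<Rightarrow> (real \<Rightarrow> real \<Rightarrow> cser) \<Rightarrow> bool" where
  "solution m n j q S \<longleftrightarrow> (\<forall>x t. Ymem m n (q x t)) \<and> Scond m n q S \<and> flow_eq m n j q S"

definition conn_x :: "nat \<Rightarrow> nat \<Rightarrow> (real \<Rightarrow> real \<Rightarrow> cmat) \<Rightarrow> real \<Rightarrow> real \<Rightarrow> complex \<Rightarrow> cmat" where
  "conn_x m n q x t z = Jeval m n z + q x t"

definition conn_t :: "nat \<Rightarrow> nat \<Rightarrow> nat \<Rightarrow> (real \<Rightarrow> real \<Rightarrow> cser) \<Rightarrow> real \<Rightarrow> real \<Rightarrow> complex \<Rightarrow> cmat" where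
  "conn_t m n j S x t z = pos_eval (spow (Nd m n) (S x t) (2 * j - 1)) z"

text \<open>The right side of the Riccati equation found in \<open>projection_deriv\<close>: the
  range moves with the connection at \<open>a\<close>, the kernel with the one at
  \<open>- a\<close>.\<close>

definition proj_vel :: "nat \<Rightarrow> complex \<Rightarrow> (complex \<Rightarrow> cmat) \<Rightarrow> cmat \<Rightarrow> cmat" where
  "proj_vel N a A P = mmul N P (mmul N (A (- a)) (idm N - P)) - mmul N (idm N - P) (mmul N (A a) P)"

text \<open>\<open>B\<close> is the gauge transform of \<open>A\<close> by \<open>kmat a P\<close>, the derivative of \<open>P\<close> being \<open>D\<close>.\<close>
definition gauge :: "nat \<Rightarrow> complex \<Rightarrow> cmat \<Rightarrow> cmat \<Rightarrow> (complex \<Rightarrow> cmat) \<Rightarrow> (complex \<Rightarrow> cmat) \<Rightarrow> bool" where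
  "gauge N a P D A B \<longleftrightarrow> (\<forall>z. mmul N (B z) (smul z (idm N) - Tmat N a P)
      = mmul N (smul z (idm N) - Tmat N a P) (A z) + smul (2 * a) D)"

text \<open>Only the two velocities of \<open>P\<close> enter, so this applies both to projections
  moved by the frame and to their conjugates by \<open>phi\<close>. The gauge conclusions carry
  parallel matrices over to the new connection.\<close>

lemma darboux_step:
  fixes q :: "real \<Rightarrow> real \<Rightarrow> cmat" and P :: "real \<Rightarrow> real \<Rightarrow> cmat"
  assumes sol: "solution m n j q S" and P: "\<And>x t. Oproj m n (P x t)"
    and Px: "\<And>x t. has_mderiv (\<lambda>y. P y t) (proj_vel (Nd m n) a (conn_x m n q x t) (P x t)) x"
    and Pt: "\<And>x t. has_mderiv (\<lambda>s. P x s) (proj_vel (Nd m n) a (conn_t m n j S x t) (P x t)) t"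
    and q': "\<And>x t. q' x t = q x t + smul (2 * a) (brk (Nd m n) (emat m n) (P x t))"
  obtains S' where "solution m n j q' S'"
    "\<And>x t. gauge (Nd m n) a (P x t) (proj_vel (Nd m n) a (conn_x m n q x t) (P x t))
        (conn_x m n q x t) (conn_x m n q' x t)"
    "\<And>x t. gauge (Nd m n) a (P x t) (proj_vel (Nd m n) a (conn_t m n j S x t) (P x t))
        (conn_t m n j S x t) (conn_t m n j S' x t)"
proof -
  let ?N = "Nd m n" and ?e = "emat m n" and ?b = "bmat m n"
  let ?k = "\<lambda>x t. kser ?N a (P x t)" and ?k' = "\<lambda>x t. kser ?N (- a) (P x t)"
  let ?U = "\<lambda>x t. lin (?b + q x t) ?e" and ?U' = "\<lambda>x t. lin (?b + q' x t) ?e"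
  define S' where "S' x t = Defs.smult ?N (?k x t) (Defs.smult ?N (S x t) (?k' x t))" for x t
  have wP [simp]: "wfm ?N (P x t)" "mmul ?N (P x t) (P x t) = P x t" for x t
    using P[of x t] by (auto simp: Oproj_def)
  have PP: "mmul ?N (P x t) (mmul ?N (P x t) X) = mmul ?N (P x t) X" for x t X
    by (simp only: mmul_assoc[symmetric] wP)
  have Y: "Ymem m n (q x t)" for x t using sol by (auto simp: solution_def)
  have wq [simp]: "wfm ?N (q x t)" for x t using Y by (rule wfm_Ymem)
  have Y': "Ymem m n (q' x t)" for x t unfolding q' by (intro Ymem_step Y P)
  then have wq' [simp]: "wfm ?N (q' x t)" for x t by (rule wfm_Ymem)
  have Sc: "Scond m n q S" using sol by (auto simp: solution_def)
  then have S: "sbounded (S x t)" "wfs ?N (S x t)" "lax ?N (\<lambda>y. S y t) (?U x t) (?U x t) x"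
    "\<exists>g. grp_minus m n g \<and> Defs.smult ?N (S x t) g = Defs.smult ?N g (Jser m n)" for x t
    unfolding Scond_iff by blast+
  then have bS: "bnd 1 (S x t)" for x t using bnd_dressed by blast
  note [simp] = S(1)
  have kk': "Defs.smult ?N (?k x t) (?k' x t) = sone ?N"
    and k'k: "Defs.smult ?N (?k' x t) (?k x t) = sone ?N" for x t
    using kser_inverse[of ?N "P x t" a] kser_inverse[of ?N "P x t" "- a"] by simp_all
  have k'k_left: "Defs.smult ?N (?k' x t) (Defs.smult ?N (?k x t) X) = X"
    if "sbounded X" "wfs ?N X" for X x t
    using that by (simp add: smult_assoc[symmetric] k'k smult_sone_left)

  have lk: "lax ?N (\<lambda>y. ?k y t) (?U x t) (?U' x t) x" for x t
    by (rule lax_kser[OF _ _ _ _ Px])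
      (simp_all add: q' proj_vel_def conn_x_def Jeval_def brk_def mmul_distribs PP,
        simp add: fun_eq_iff smul_def algebra_simps)
  \<comment> \<open>The inverse factor is again a simple factor: \<open>lax_kser\<close> applies
    with \<open>a\<close> negated and the potentials exchanged.\<close>
  have lk': "lax ?N (\<lambda>y. ?k' y t) (?U' x t) (?U x t) x" for x t
    by (rule lax_kser[OF _ _ _ _ Px])
      (simp_all add: q' proj_vel_def conn_x_def Jeval_def brk_def mmul_distribs PP,
        simp_all add: fun_eq_iff smul_def algebra_simps)
  have lax': "lax ?N (\<lambda>y. S' y t) (?U' x t) (?U' x t) x" for x t
    unfolding S'_def
    by (rule lax_smult[OF bnd_kser bnd_smult[OF bS bnd_kser] _ _ _ lk
          lax_smult[OF bS bnd_kser _ _ _ S(3) lk']]) simp_all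
  have "\<exists>g. grp_minus m n g \<and> Defs.smult ?N (S' x t) g = Defs.smult ?N g (Jser m n)" for x t
  proof -
    obtain g where g: "grp_minus m n g" "Defs.smult ?N (S x t) g = Defs.smult ?N g (Jser m n)"
      using S(4) by blast
    have [simp]: "sbounded g" "wfs ?N g" "sbounded (Jser m n)"
      using g(1) by (auto simp: grp_minus_iff sbounded_iff Jser_lin intro: bnd_lin)
    have "Defs.smult ?N (S' x t) (Defs.smult ?N (?k x t) g)
        = Defs.smult ?N (Defs.smult ?N (?k x t) g) (Jser m n)"
      by (simp add: S'_def smult_assoc k'k_left g(2))
    then show ?thesis using grp_minus_kser[OF P g(1)] by blast
  qed
  then have Sc': "Scond m n q' S'"
    unfolding Scond_iff using lax' by (simp add: S'_def)

  let ?Q = "\<lambda>x t. spow ?N (S x t) (2 * j - 1)" and ?Q' = "\<lambda>x t. spow ?N (S' x t) (2 * j - 1)"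
  have Q': "spow ?N (S' x t) p = Defs.smult ?N (?k x t) (Defs.smult ?N (spow ?N (S x t) p) (?k' x t))"
    for x t p
  proof (induction p)
    case 0
    show ?case by (simp add: smult_sone_left kk')
  next
    case (Suc p)
    then show ?case by (simp add: S'_def smult_assoc k'k_left)
  qed
  have bQ: "bnd (int (2 * j - 1)) (?Q x t)" for x t by (rule bnd_spow[OF bS])
  have bQ': "bnd (int (2 * j - 1)) (?Q' x t)" for x t
    using bnd_smult[OF bnd_kser bnd_smult[OF bQ bnd_kser]] unfolding Q' by simp
  \<comment> \<open>From \<open>Q' k = k Q\<close>, multiplied by the central series
    \<open>lambda - a\<close>, one gets a relation with the polynomial factor
    \<open>lambda - T\<close>.\<close>
  have rel: "Defs.smult ?N (?Q' x t) (lin (- Tmat ?N a (P x t)) (idm ?N))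
      = Defs.smult ?N (lin (- Tmat ?N a (P x t)) (idm ?N)) (?Q x t)" for x t
  proof -
    let ?z = "lin (smul (- a) (idm ?N)) (idm ?N)"
    have sbQ': "sbounded (?Q' x t)" using bQ' by (auto simp: sbounded_iff)
    have "Defs.smult ?N (?Q' x t) (Defs.smult ?N ?z (?k x t))
        = Defs.smult ?N (Defs.smult ?N (?Q' x t) ?z) (?k x t)"
      using sbQ' by (simp add: smult_assoc)
    also have "\<dots> = Defs.smult ?N ?z (Defs.smult ?N (?Q' x t) (?k x t))"
      using sbQ' by (simp add: scalar_lin_commute[symmetric] smult_assoc)
    also have "\<dots> = Defs.smult ?N (Defs.smult ?N ?z (?k x t)) (?Q x t)"
      by (simp add: Q' smult_assoc k'k smult_sone_right)
    finally show ?thesis by (simp add: clear_kser)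
  qed
  have tw: "mmul ?N (pos_eval (?Q' x t) z) (smul z (idm ?N) - Tmat ?N a (P x t))
      = mmul ?N (smul z (idm ?N) - Tmat ?N a (P x t)) (pos_eval (?Q x t) z)
        + (?Q x t (- 1) - ?Q' x t (- 1))" for x t z
    by (rule pos_eval_intertwine[OF bQ bQ' wfs_spow wfs_spow rel])
  have "wfm ?N (?Q x t (- 1) - ?Q' x t (- 1))" for x t
    using wfs_spow by (auto simp: wfs_def intro!: wfm_diff)
  \<comment> \<open>The change of the index \<open>- 1\<close> coefficient is \<open>2 a\<close>
    times the velocity of \<open>P\<close> in \<open>t\<close>, just what differentiating
    \<open>q' = q + 2 a [e, P]\<close> contributes.\<close>
  then have K: "?Q x t (- 1) - ?Q' x t (- 1)
      = smul (2 * a) (proj_vel ?N a (conn_t m n j S x t) (P x t))" for x t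
    unfolding proj_vel_def conn_t_def
    by (intro intertwine_boundary[OF wP, of _ "\<lambda>z. pos_eval (?Q' x t) z"] tw)
  have "has_mderiv (\<lambda>s. q' x s) (- brk ?N ?e (?Q' x t (- 1))) t" for x t
  proof -
    let ?D = "proj_vel ?N a (conn_t m n j S x t) (P x t)"
    have "has_mderiv (\<lambda>s. q x s) (- brk ?N ?e (?Q x t (- 1))) t"
      using sol flow_eq_iff[OF Sc wq] by (auto simp: solution_def)
    moreover have "has_mderiv (\<lambda>s. brk ?N ?e (P x s)) (brk ?N ?e ?D) t"
    proof -
      have "has_mderiv (\<lambda>s. mmul ?N ?e (P x s) - mmul ?N (P x s) ?e)
          ((mmul ?N 0 (P x t) + mmul ?N ?e ?D) - (mmul ?N ?D ?e + mmul ?N (P x t) 0)) t"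
        by (intro has_mderiv_diff has_mderiv_mmul has_mderiv_const Pt)
      then show ?thesis by (simp add: brk_def)
    qed
    ultimately have "has_mderiv (\<lambda>s. q' x s)
        (- brk ?N ?e (?Q x t (- 1)) + smul (2 * a) (brk ?N ?e ?D)) t"
      unfolding q' by (intro has_mderiv_add has_mderiv_smul)
    moreover have "smul (2 * a) (brk ?N ?e ?D) = brk ?N ?e (?Q x t (- 1) - ?Q' x t (- 1))"
      unfolding K by (simp add: brk_def mmul_distribs)
    moreover have "- brk ?N ?e (?Q x t (- 1)) + brk ?N ?e (?Q x t (- 1) - ?Q' x t (- 1))
        = - brk ?N ?e (?Q' x t (- 1))"
      by (simp add: brk_def mmul_distribs)
    ultimately show ?thesis by (simp only:)
  qed
  then have "flow_eq m n j q' S'"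
    using flow_eq_iff[OF Sc' wq'] by blast
  then have "solution m n j q' S'"
    using Y' Sc' by (auto simp: solution_def)
  moreover have "gauge ?N a (P x t) (proj_vel ?N a (conn_x m n q x t) (P x t))
        (conn_x m n q x t) (conn_x m n q' x t)" for x t
    unfolding gauge_def
  proof
    fix z
    show "mmul ?N (conn_x m n q' x t z) (smul z (idm ?N) - Tmat ?N a (P x t))
      = mmul ?N (smul z (idm ?N) - Tmat ?N a (P x t)) (conn_x m n q x t z)
        + smul (2 * a) (proj_vel ?N a (conn_x m n q x t) (P x t))"
      by (simp add: q' proj_vel_def conn_x_def Jeval_def Tmat_def brk_def mmul_distribs PP)
        (simp add: fun_eq_iff smul_def algebra_simps)
  qed
  moreover have "gauge ?N a (P x t) (proj_vel ?N a (conn_t m n j S x t) (P x t))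
        (conn_t m n j S x t) (conn_t m n j S' x t)" for x t
    unfolding gauge_def K[symmetric] using tw by (simp add: conn_t_def)
  ultimately show ?thesis by (rule that)
qed

subsection \<open>Projections moved by a frame\<close>

text \<open>\<open>P\<close> projects onto the range of \<open>Mp\<close> along the range of \<open>Mq\<close>, where \<open>Mp\<close> and \<open>Mq\<close> are parallel
  for the connection with coefficients \<open>U\<close>, \<open>V\<close> at the spectral values \<open>a\<close> and \<open>- a\<close>. For
  the dressed potential this needs the frame at these two values only, away from
  the poles of the previous dressing factor.\<close>
definition moved :: "nat \<Rightarrow> complex \<Rightarrow> (real \<Rightarrow> real \<Rightarrow> complex \<Rightarrow> cmat) \<Rightarrow>
    (real \<Rightarrow> real \<Rightarrow> complex \<Rightarrow> cmat) \<Rightarrow> (real \<Rightarrow> real \<Rightarrow> cmat) \<Rightarrow> bool" where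
  "moved N a U V P \<longleftrightarrow> (\<exists>Mp Mq R S. \<forall>x t.
      has_mderiv (\<lambda>y. Mp y t) (- mmul N (U x t a) (Mp x t)) x
    \<and> has_mderiv (\<lambda>y. Mq y t) (- mmul N (U x t (- a)) (Mq x t)) x
    \<and> has_mderiv (\<lambda>s. Mp x s) (- mmul N (V x t a) (Mp x t)) t
    \<and> has_mderiv (\<lambda>s. Mq x s) (- mmul N (V x t (- a)) (Mq x t)) t
    \<and> R x t = Mp x t + Mq x t \<and> mmul N (R x t) (S x t) = idm N \<and> mmul N (S x t) (R x t) = idm N
    \<and> wfm N (S x t) \<and> wfm N (R x t) \<and> mmul N (P x t) (R x t) = Mp x t)"

lemma moved_deriv:
  assumes "moved N a U V P" "\<And>x t. mmul N (P x t) (P x t) = P x t" "\<And>x t. wfm N (P x t)"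
  shows "has_mderiv (\<lambda>y. P y t) (proj_vel N a (U x t) (P x t)) x"
    "has_mderiv (\<lambda>s. P x s) (proj_vel N a (V x t) (P x t)) t"
proof -
  obtain Mp Mq R S where M: "\<And>x t. has_mderiv (\<lambda>y. Mp y t) (- mmul N (U x t a) (Mp x t)) x"
    "\<And>x t. has_mderiv (\<lambda>y. Mq y t) (- mmul N (U x t (- a)) (Mq x t)) x"
    "\<And>x t. has_mderiv (\<lambda>s. Mp x s) (- mmul N (V x t a) (Mp x t)) t"
    "\<And>x t. has_mderiv (\<lambda>s. Mq x s) (- mmul N (V x t (- a)) (Mq x t)) t"
    and R: "\<And>x t. R x t = Mp x t + Mq x t" "\<And>x t. mmul N (R x t) (S x t) = idm N"
    "\<And>x t. mmul N (S x t) (R x t) = idm N" "\<And>x t. wfm N (S x t)" "\<And>x t. wfm N (R x t)"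
    "\<And>x t. mmul N (P x t) (R x t) = Mp x t"
    using assms(1) unfolding moved_def by blast
  show "has_mderiv (\<lambda>y. P y t) (proj_vel N a (U x t) (P x t)) x"
    unfolding proj_vel_def
    by (rule projection_deriv[where R = "\<lambda>y. R y t" and S = "\<lambda>y. S y t", OF M(1,2)])
      (use R assms(2,3) in blast)+
  show "has_mderiv (\<lambda>s. P x s) (proj_vel N a (V x t) (P x t)) t"
    unfolding proj_vel_def
    by (rule projection_deriv[where R = "\<lambda>s. R x s" and S = "\<lambda>s. S x s", OF M(3,4)])
      (use R assms(2,3) in blast)+
qed

text \<open>\<open>z - T\<close> has derivative \<open>- 2 a D\<close>, and the gauge equation
  absorbs this term when the connection changes from \<open>A\<close> to \<open>B\<close>.\<close>

lemma gauge_parallel: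
  assumes M: "has_mderiv M (- mmul N (A z) (M x)) x" and P: "has_mderiv P D x"
    and g: "gauge N a (P x) D A B"
  shows "has_mderiv (\<lambda>y. mmul N (smul z (idm N) - Tmat N a (P y)) (M y))
    (- mmul N (B z) (mmul N (smul z (idm N) - Tmat N a (P x)) (M x))) x"
proof -
  let ?K = "\<lambda>y. smul z (idm N) - Tmat N a (P y)"
  have "has_mderiv ?K (0 - (smul (2 * a) D - 0)) x"
    unfolding Tmat_def by (intro has_mderiv_diff has_mderiv_const has_mderiv_smul P)
  then have "has_mderiv (\<lambda>y. mmul N (?K y) (M y))
      (mmul N (0 - (smul (2 * a) D - 0)) (M x) + mmul N (?K x) (- mmul N (A z) (M x))) x"
    using M by (rule has_mderiv_mmul)
  moreover have "mmul N (B z) (mmul N (?K x) (M x))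
      = mmul N (mmul N (?K x) (A z) + smul (2 * a) D) (M x)"
    using g by (simp add: gauge_def mmul_assoc[symmetric])
  then have "mmul N (0 - (smul (2 * a) D - 0)) (M x) + mmul N (?K x) (- mmul N (A z) (M x))
      = - mmul N (B z) (mmul N (?K x) (M x))"
    by (simp add: mmul_add_left mmul_minus_left mmul_minus_right mmul_assoc)
  ultimately show ?thesis by simp
qed

text \<open>The new parallel matrices are \<open>(a2 - T1) Mp\<close> and
  \<open>(- a2 - T1) Mq\<close>, parallel by the gauge equations. By \<open>phi_on_second\<close>
  both factors act as the one matrix \<open>phi\<close>, so range and kernel are carried along by
  \<open>phi\<close> and the projection is conjugated by it.\<close>

lemma moved_step:
  assumes mv: "moved N a2 U V P2"
    and P1: "\<And>x t. wfm N (P1 x t)" "\<And>x t. mmul N (P1 x t) (P1 x t) = P1 x t"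
    and P2: "\<And>x t. wfm N (P2 x t)" "\<And>x t. mmul N (P2 x t) (P2 x t) = P2 x t"
    and D: "\<And>x t. has_mderiv (\<lambda>y. P1 y t) (Dx x t) x" "\<And>x t. has_mderiv (\<lambda>s. P1 x s) (Dt x t) t"
    and g: "\<And>x t. gauge N a1 (P1 x t) (Dx x t) (U x t) (U' x t)"
      "\<And>x t. gauge N a1 (P1 x t) (Dt x t) (V x t) (V' x t)"
    and phi: "\<And>x t. phi x t = smul (a1 - a2) (idm N) + smul (2 * a2) (P2 x t) - smul (2 * a1) (P1 x t)"
    and inv: "\<And>x t. invertible_m N (phi x t)"
  shows "moved N a2 U' V' (\<lambda>x t. mmul N (mmul N (phi x t) (P2 x t)) (minv N (phi x t)))"
proof -
  obtain Mp Mq R S where M: "\<And>x t. has_mderiv (\<lambda>y. Mp y t) (- mmul N (U x t a2) (Mp x t)) x"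
    "\<And>x t. has_mderiv (\<lambda>y. Mq y t) (- mmul N (U x t (- a2)) (Mq x t)) x"
    "\<And>x t. has_mderiv (\<lambda>s. Mp x s) (- mmul N (V x t a2) (Mp x t)) t"
    "\<And>x t. has_mderiv (\<lambda>s. Mq x s) (- mmul N (V x t (- a2)) (Mq x t)) t"
    and R: "\<And>x t. R x t = Mp x t + Mq x t" "\<And>x t. mmul N (R x t) (S x t) = idm N"
    "\<And>x t. mmul N (S x t) (R x t) = idm N" "\<And>x t. wfm N (S x t)" "\<And>x t. wfm N (R x t)"
    "\<And>x t. mmul N (P2 x t) (R x t) = Mp x t"
    using mv unfolding moved_def by blast
  let ?K = "\<lambda>z x t. smul z (idm N) - Tmat N a1 (P1 x t)"
  let ?psi = "\<lambda>x t. minv N (phi x t)"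
  note psi = invertible_mD[OF inv]
  have Mq: "Mq x t = mmul N (idm N - P2 x t) (R x t)" for x t
  proof -
    have "Mq x t = R x t - Mp x t" using R(1)[of x t] by simp
    then show ?thesis using R(5)[of x t] by (simp only: mmul_diff_left mmul_idm_left R(6))
  qed
  have K: "mmul N (?K a2 x t) (P2 x t) = mmul N (phi x t) (P2 x t)"
    "mmul N (?K (- a2) x t) (idm N - P2 x t) = mmul N (phi x t) (idm N - P2 x t)" for x t
    using phi_on_second[OF P1 P2 phi psi(2-4)] by auto
  have KMp: "mmul N (?K a2 x t) (Mp x t) = mmul N (phi x t) (mmul N (P2 x t) (R x t))"
    and KMq: "mmul N (?K (- a2) x t) (Mq x t) = mmul N (phi x t) (mmul N (idm N - P2 x t) (R x t))"
    for x t
    unfolding Mq R(6)[symmetric] using K[of x t] by (simp_all only: mmul_assoc[symmetric])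
  have cancel: "mmul N (?psi x t) (mmul N (phi x t) X) = mmul N (idm N) X"
    "mmul N (phi x t) (mmul N (?psi x t) X) = mmul N (idm N) X"
    "mmul N (R x t) (mmul N (S x t) X) = mmul N (idm N) X"
    "mmul N (S x t) (mmul N (R x t) X) = mmul N (idm N) X" for x t X
    by (simp_all only: mmul_assoc[symmetric] psi R(2,3))
  have "mmul N (phi x t) (R x t)
      = mmul N (?K a2 x t) (Mp x t) + mmul N (?K (- a2) x t) (Mq x t)" for x t
    unfolding KMp KMq using R(5)[of x t] by (simp add: mmul_diff_left mmul_diff_right)
  moreover have "mmul N (mmul N (phi x t) (R x t)) (mmul N (S x t) (?psi x t)) = idm N"
    "mmul N (mmul N (S x t) (?psi x t)) (mmul N (phi x t) (R x t)) = idm N" for x t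
    using psi R(2-5) by (simp_all add: mmul_assoc cancel)
  moreover have "mmul N (mmul N (mmul N (phi x t) (P2 x t)) (?psi x t)) (mmul N (phi x t) (R x t))
      = mmul N (?K a2 x t) (Mp x t)" for x t
    unfolding KMp using R(5)[of x t] by (simp add: mmul_assoc cancel)
  ultimately show ?thesis
    unfolding moved_def
    using gauge_parallel[OF M(1) D(1) g(1)] gauge_parallel[OF M(2) D(1) g(1)]
      gauge_parallel[OF M(3) D(2) g(2)] gauge_parallel[OF M(4) D(2) g(2)]
    by (intro exI[of _ "\<lambda>x t. mmul N (?K a2 x t) (Mp x t)"]
        exI[of _ "\<lambda>x t. mmul N (?K (- a2) x t) (Mq x t)"]
        exI[of _ "\<lambda>x t. mmul N (phi x t) (R x t)"]
        exI[of _ "\<lambda>x t. mmul N (S x t) (?psi x t)"]) simp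
qed

text \<open>The reality condition turns the two inclusions between ranges into their orthogonal
  counterparts, with \<open>a\<close> replaced by \<open>- a\<close>.\<close>
lemma projection_onto_frame:
  assumes F: "wfm (Nd m n) Fp" "wfm (Nd m n) Fq"
    and G: "mmul (Nd m n) Fp (adj m n Fq) = idm (Nd m n)" "mmul (Nd m n) (adj m n Fq) Fp = idm (Nd m n)"
      "mmul (Nd m n) Fq (adj m n Fp) = idm (Nd m n)" "mmul (Nd m n) (adj m n Fp) Fq = idm (Nd m n)"
    and p: "Oproj m n p" and P: "Oproj_onto m n P (mvec (Nd m n) (adj m n Fq) ` mimage (Nd m n) p)"
  defines "R \<equiv> mmul (Nd m n) (adj m n Fq) p + mmul (Nd m n) (adj m n Fp) (idm (Nd m n) - p)"
    and "S \<equiv> mmul (Nd m n) p (mmul (Nd m n) Fp P)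
      + mmul (Nd m n) (idm (Nd m n) - p) (mmul (Nd m n) Fq (idm (Nd m n) - P))"
  shows "mmul (Nd m n) P (mmul (Nd m n) (adj m n Fq) p) = mmul (Nd m n) (adj m n Fq) p"
    "mmul (Nd m n) p (mmul (Nd m n) Fp P) = mmul (Nd m n) Fp P"
    "mmul (Nd m n) P R = mmul (Nd m n) (adj m n Fq) p"
    "mmul (Nd m n) R S = idm (Nd m n)" "mmul (Nd m n) S R = idm (Nd m n)"
proof -
  let ?N = "Nd m n" and ?Gp = "adj m n Fq" and ?Gq = "adj m n Fp"
  have p': "wfm ?N p" "mmul ?N p p = p" "adj m n p = p"
    and P': "wfm ?N P" "mmul ?N P P = P" "adj m n P = P" "mimage ?N P = mvec ?N ?Gp ` mimage ?N p"
    using p P by (auto simp: Oproj_def Oproj_onto_def)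
  show 1: "mmul ?N P (mmul ?N ?Gp p) = mmul ?N ?Gp p"
    by (rule mimage_subset_fixed) (simp_all add: P' mimage_mmul)
  have "mimage ?N (mmul ?N Fp P) = mimage ?N (mmul ?N (mmul ?N Fp ?Gp) p)"
    by (simp only: mimage_mmul[symmetric] P' mmul_assoc)
  then have "mimage ?N (mmul ?N Fp P) = mimage ?N p"
    by (simp add: G p'(1))
  then show 2: "mmul ?N p (mmul ?N Fp P) = mmul ?N Fp P"
    by (intro mimage_subset_fixed[OF equalityD1 p'(2) wfm_mmul])
  \<comment> \<open>The adjoint of the first inclusion says that \<open>Fq\<close> maps the kernel
    of \<open>P\<close> into that of \<open>p\<close>; likewise the next line for \<open>?Gq\<close>
    and the kernel of \<open>p\<close>.\<close>
  have 3: "mmul ?N (mmul ?N p Fq) P = mmul ?N p Fq"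
    using arg_cong[OF 1, of "adj m n"] F p' P' by (simp add: adj_mmul adj_adj)
  have 4: "mmul ?N (mmul ?N P ?Gq) p = mmul ?N P ?Gq"
    using arg_cong[OF 2, of "adj m n"] p' P' by (simp add: adj_mmul)
  show 5: "mmul ?N P R = mmul ?N ?Gp p"
    unfolding R_def using 1 4 by (simp add: mmul_add_right mmul_diff_right mmul_assoc)
  have c: "mmul ?N Fp (mmul ?N ?Gp X) = mmul ?N (idm ?N) X" "mmul ?N ?Gp (mmul ?N Fp X) = mmul ?N (idm ?N) X"
    "mmul ?N Fq (mmul ?N ?Gq X) = mmul ?N (idm ?N) X" "mmul ?N ?Gq (mmul ?N Fq X) = mmul ?N (idm ?N) X"
    "mmul ?N p (mmul ?N p X) = mmul ?N p X" for X
    by (simp_all only: mmul_assoc[symmetric] G p')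
  have wR: "wfm ?N R" by (simp add: R_def)
  have PR: "mmul ?N (idm ?N - P) R = mmul ?N ?Gq (idm ?N - p)"
    unfolding mmul_diff_left mmul_idm_left[OF wR] 5 by (simp add: R_def)
  have "mmul ?N S R = mmul ?N p (mmul ?N Fp (mmul ?N P R))
      + mmul ?N (idm ?N - p) (mmul ?N Fq (mmul ?N (idm ?N - P) R))"
    unfolding S_def by (simp only: mmul_add_left mmul_assoc)
  also have "\<dots> = idm ?N"
    unfolding 5 PR using p' by (simp add: mmul_distribs c G)
  finally show "mmul ?N S R = idm ?N" .
  have pS: "mmul ?N p S = mmul ?N Fp P"
    unfolding S_def using 2 p' by (simp add: mmul_distribs c G)
  have qS: "mmul ?N (idm ?N - p) S = mmul ?N Fq (idm ?N - P)"
    unfolding S_def using 3 F p' P'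
    by (simp add: mmul_distribs c G)
  have "mmul ?N R S = mmul ?N ?Gp (mmul ?N p S) + mmul ?N ?Gq (mmul ?N (idm ?N - p) S)"
    unfolding R_def by (simp only: mmul_add_left mmul_assoc)
  also have "\<dots> = idm ?N"
    unfolding pS qS using P' by (simp add: mmul_distribs c G)
  finally show "mmul ?N R S = idm ?N" .
qed

section \<open>The inverse frame as a parallel matrix\<close>

lemma frame_inverse:
  assumes "frame_sol m n j q F"
  shows "mmul (Nd m n) (F x t z) (adj m n (F x t (- z))) = idm (Nd m n)"
    "mmul (Nd m n) (adj m n (F x t (- z))) (F x t z) = idm (Nd m n)"
    "minv (Nd m n) (F x t z) = adj m n (F x t (- z))"
    "wfm (Nd m n) (F x t z)"
proof -
  have F: "wfm (Nd m n) (F x t z)" "mdet (Nd m n) (F x t z) = 1" "sigma m n (F x t (- z)) = F x t z" for z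
    using assms unfolding frame_sol_def by blast+
  have "invertible_m (Nd m n) (F x t (- z))"
    using F(1,2)[of "- z"] by (intro invertible_m_mdet) simp_all
  from adj_inverse[OF F(3) this]
  show "mmul (Nd m n) (F x t z) (adj m n (F x t (- z))) = idm (Nd m n)"
    "mmul (Nd m n) (adj m n (F x t (- z))) (F x t z) = idm (Nd m n)"
    "minv (Nd m n) (F x t z) = adj m n (F x t (- z))" .
  show "wfm (Nd m n) (F x t z)" by (rule F)
qed

text \<open>Differentiating the inverse turns \<open>F^{-1} F_x = A\<close> into
  \<open>G_x = - A G\<close>, the form used in \<open>moved\<close>, with
  \<open>G = adj (F (- z))\<close>.\<close>

lemma frame_parallel:
  assumes "frame_sol m n j q F"
  obtains S where "solution m n j q S"
    "\<And>x t z. has_mderiv (\<lambda>y. adj m n (F y t (- z)))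
      (- mmul (Nd m n) (conn_x m n q x t z) (adj m n (F x t (- z)))) x"
    "\<And>x t z. has_mderiv (\<lambda>s. adj m n (F x s (- z)))
      (- mmul (Nd m n) (conn_t m n j S x t z) (adj m n (F x t (- z)))) t"
proof -
  let ?N = "Nd m n"
  obtain S where S: "solution m n j q S"
    and dF: "\<And>z. diffx (\<lambda>x t. F x t z)" "\<And>z. difft (\<lambda>x t. F x t z)"
    and U: "\<And>x t z. mmul ?N (minv ?N (F x t z)) (pdx (\<lambda>x t. F x t z) x t) = conn_x m n q x t z"
    and V: "\<And>x t z. mmul ?N (minv ?N (F x t z)) (pdt (\<lambda>x t. F x t z) x t) = conn_t m n j S x t z"
    using assms unfolding frame_sol_def solution_def conn_x_def conn_t_def by blast
  note inv = frame_inverse[OF assms]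
  have dx: "has_mderiv (\<lambda>y. adj m n (F y t (- z)))
      (- mmul ?N (conn_x m n q x t z) (adj m n (F x t (- z)))) x" for x t z
  proof -
    have G: "has_mderiv (\<lambda>y. adj m n (F y t (- z))) (adj m n (pdx (\<lambda>x t. F x t (- z)) x t)) x"
      by (intro has_mderiv_adj diffxD[OF dF(1)])
    from has_mderiv_inverse[OF diffxD[OF dF(1)] this inv(1,2) wfm_adj]
    have "adj m n (pdx (\<lambda>x t. F x t (- z)) x t)
        = - mmul ?N (conn_x m n q x t z) (adj m n (F x t (- z)))"
      unfolding U[symmetric] inv(3) mmul_assoc .
    then show ?thesis using G by simp
  qed
  have dt: "has_mderiv (\<lambda>s. adj m n (F x s (- z)))
      (- mmul ?N (conn_t m n j S x t z) (adj m n (F x t (- z)))) t" for x t z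
  proof -
    have G: "has_mderiv (\<lambda>s. adj m n (F x s (- z))) (adj m n (pdt (\<lambda>x t. F x t (- z)) x t)) t"
      by (intro has_mderiv_adj difftD[OF dF(2)])
    from has_mderiv_inverse[OF difftD[OF dF(2)] this inv(1,2) wfm_adj]
    have "adj m n (pdt (\<lambda>x t. F x t (- z)) x t)
        = - mmul ?N (conn_t m n j S x t z) (adj m n (F x t (- z)))"
      unfolding V[symmetric] inv(3) mmul_assoc .
    then show ?thesis using G by simp
  qed
  show ?thesis using that[OF S dx dt] .
qed

text \<open>The witnesses are \<open>F(a)^{-1} p\<close> and \<open>F(- a)^{-1} (1 - p)\<close>: a
  constant right factor keeps a matrix parallel.\<close>

lemma moved_frame:
  assumes F: "frame_sol m n j q F"
    and G: "\<And>x t z. has_mderiv (\<lambda>y. adj m n (F y t (- z)))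
        (- mmul (Nd m n) (U x t z) (adj m n (F x t (- z)))) x"
      "\<And>x t z. has_mderiv (\<lambda>s. adj m n (F x s (- z)))
        (- mmul (Nd m n) (V x t z) (adj m n (F x t (- z)))) t"
    and p: "Oproj m n p"
    and P: "\<And>x t. Oproj_onto m n (P x t) (mvec (Nd m n) (minv (Nd m n) (F x t a)) ` mimage (Nd m n) p)"
  shows "moved (Nd m n) a U V P"
proof -
  let ?N = "Nd m n"
  note inv = frame_inverse[OF F]
  have mult: "has_mderiv (\<lambda>y. mmul ?N (M y) B) (- mmul ?N A (mmul ?N (M x) B)) x"
    if "has_mderiv M (- mmul ?N A (M x)) x" for M A B x
    using has_mderiv_mmul[OF that has_mderiv_const, of ?N B] by (simp add: mmul_minus_left mmul_assoc)
  note proj = projection_onto_frame[OF inv(4) inv(4) inv(1,2)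
      inv(1)[where z = "- a", unfolded minus_minus] inv(2)[where z = "- a", unfolded minus_minus] p P[unfolded inv(3)]]
  show ?thesis
    unfolding moved_def
    by (intro exI[of _ "\<lambda>x t. mmul ?N (adj m n (F x t (- a))) p"]
        exI[of _ "\<lambda>x t. mmul ?N (adj m n (F x t a)) (idm ?N - p)"]
        exI[of _ "\<lambda>x t. mmul ?N (adj m n (F x t (- a))) p + mmul ?N (adj m n (F x t a)) (idm ?N - p)"]
        exI[of _ "\<lambda>x t. mmul ?N p (mmul ?N (F x t a) (P x t))
          + mmul ?N (idm ?N - p) (mmul ?N (F x t (- a)) (idm ?N - P x t))"]
        allI conjI mult proj G G[where z = "- a", unfolded minus_minus] refl wfm_add wfm_mmul)
qed

text \<open>Self-adjointness fixes the kernel once the range is known: the adjoint of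
  \<open>P p = p\<close> is \<open>p P = p\<close>, while equal ranges also give
  \<open>p P = P\<close>.\<close>

lemma Oproj_onto_unique:
  assumes "Oproj m n p" "Oproj_onto m n P (mimage (Nd m n) p)"
  shows "P = p"
proof -
  let ?N = "Nd m n"
  have p: "wfm ?N p" "mmul ?N p p = p" "adj m n p = p"
    and P: "wfm ?N P" "mmul ?N P P = P" "adj m n P = P" "mimage ?N P = mimage ?N p"
    using assms by (auto simp: Oproj_def Oproj_onto_def)
  have "mmul ?N P p = p"
    by (rule mimage_subset_fixed[OF equalityD2[OF P(4)] P(2) p(1)])
  then have "mmul ?N p P = p"
    using p(3) P(3) by (metis adj_mmul)
  moreover have "mmul ?N p P = P"
    by (rule mimage_subset_fixed[OF equalityD1[OF P(4)] p(2) P(1)])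
  ultimately show ?thesis by simp
qed

section \<open>The simple factor at a regular spectral value and the image of the conjugated
  projection\<close>

lemma kmat_Tmat:
  assumes "b \<noteq> a"
  shows "kmat m n a p b = smul (1 / (b - a)) (smul b (idm (Nd m n)) - Tmat (Nd m n) a p)"
  using assms by (simp add: kmat_def Tmat_def fun_eq_iff smul_def divide_simps)
    (simp add: algebra_simps)

text \<open>Up to scalars the factor is \<open>b - T\<close>, and
  \<open>(b - T) (b + T) = b^2 - a^2\<close>.\<close>

lemma invertible_kmat:
  assumes "wfm (Nd m n) p" "mmul (Nd m n) p p = p" "b \<noteq> a" "b \<noteq> - a"
  shows "invertible_m (Nd m n) (kmat m n a p b)"
proof -
  let ?N = "Nd m n"
  let ?c = "1 / (b - a)" and ?d = "1 / (b + a)"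
  have ab: "b + a \<noteq> 0" "b - a \<noteq> 0" using assms(3,4) by (auto simp: add_eq_0_iff2)
  have one: "?c * (?d * ((b + a) * (b - a))) = 1" "?d * (?c * ((b + a) * (b - a))) = 1"
    using ab by simp_all
  have K: "kmat m n a p b = smul ?c (smul (b + a) (idm ?N) - smul (2 * a) p)"
    unfolding kmat_Tmat[OF assms(3)] Tmat_def
    by (simp add: fun_eq_iff smul_def algebra_simps)
  let ?L = "smul ?d (smul (b - a) (idm ?N) + smul (2 * a) p)"
  have "mmul ?N (smul (b + a) (idm ?N) - smul (2 * a) p) (smul (b - a) (idm ?N) + smul (2 * a) p)
      = smul ((b + a) * (b - a)) (idm ?N)"
    "mmul ?N (smul (b - a) (idm ?N) + smul (2 * a) p) (smul (b + a) (idm ?N) - smul (2 * a) p)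
      = smul ((b + a) * (b - a)) (idm ?N)"
    using assms(1,2) by (simp_all add: mmul_distribs)
      (simp_all add: fun_eq_iff smul_def algebra_simps)
  then have "mmul ?N (kmat m n a p b) ?L = idm ?N" "mmul ?N ?L (kmat m n a p b) = idm ?N"
    unfolding K using one by (simp_all only: mmul_smul_left mmul_smul_right smul_smul mult.assoc smul_one)
  moreover have "wfm ?N (kmat m n a p b)" "wfm ?N ?L"
    using assms(1) by (simp_all add: K)
  ultimately show ?thesis unfolding invertible_m_def by blast
qed

text \<open>Up to the scalar \<open>c\<close>, \<open>K\<close> acts as \<open>phi\<close> on the
  range of \<open>p\<close>, and \<open>K'\<close> as \<open>phi'\<close> on the range of
  \<open>P\<close>. So the inverse dressed frame takes \<open>phi p\<close> back to
  \<open>p\<close>, then by \<open>G\<close> into the range of \<open>P\<close>, and finally on by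
  \<open>phi'\<close>.\<close>

lemma dressed_image:
  assumes F: "mmul N F G = idm N" "mmul N G F = idm N"
    and P: "wfm N P" "mmul N p (mmul N F P) = mmul N F P" "mmul N P (mmul N G p) = mmul N G p"
      "mmul N P P = P"
    and K: "invertible_m N K" "invertible_m N K'"
    and phi: "invertible_m N phi" "invertible_m N phi'"
    and c: "c \<noteq> 0" "mmul N K p = smul c (mmul N phi p)" "mmul N K' P = smul c (mmul N phi' P)"
  shows "mvec N (minv N (mmul N (mmul N K F) (minv N K'))) ` mimage N (mmul N (mmul N phi p) (minv N phi))
    = mimage N (mmul N (mmul N phi' P) (minv N phi'))"
proof -
  note Ki = invertible_mD[OF K(1)] and K'i = invertible_mD[OF K(2)]
  note phii = invertible_mD[OF phi(1)] and phi'i = invertible_mD[OF phi(2)]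
  have cancel: "mmul N F (mmul N G X) = mmul N (idm N) X" "mmul N G (mmul N F X) = mmul N (idm N) X"
    "mmul N K (mmul N (minv N K) X) = mmul N (idm N) X" "mmul N (minv N K) (mmul N K X) = mmul N (idm N) X"
    "mmul N K' (mmul N (minv N K') X) = mmul N (idm N) X" "mmul N (minv N K') (mmul N K' X) = mmul N (idm N) X"
    "mmul N phi (mmul N (minv N phi) X) = mmul N (idm N) X" "mmul N (minv N phi) (mmul N phi X) = mmul N (idm N) X"
    "mmul N phi' (mmul N (minv N phi') X) = mmul N (idm N) X" "mmul N (minv N phi') (mmul N phi' X) = mmul N (idm N) X"
    for X by (simp_all only: mmul_assoc[symmetric] F Ki K'i phii phi'i)
  have inv: "minv N (mmul N (mmul N K F) (minv N K')) = mmul N K' (mmul N G (minv N K))"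
    by (rule minv_eqI) (simp_all add: mmul_assoc cancel Ki K'i)
  have P3: "mmul N P (mmul N G (mmul N p X)) = mmul N G (mmul N p X)"
    and P2: "mmul N p (mmul N F (mmul N P X)) = mmul N F (mmul N P X)"
    and PP: "mmul N P (mmul N P X) = mmul N P X" for X
    using P(2-4) by (metis mmul_assoc)+
  have K'P: "mmul N K' (mmul N P X) = smul c (mmul N phi' (mmul N P X))" for X
    using c(3) by (metis mmul_assoc mmul_smul_left)
  have phi_p: "mmul N phi (mmul N p X) = smul (inverse c) (mmul N K (mmul N p X))" for X
  proof -
    have "mmul N phi p = smul (inverse c) (mmul N K p)"
      using c(1,2) by (simp add: smul_smul)
    then show ?thesis by (metis mmul_assoc mmul_smul_left)
  qed
  let ?t = "mmul N (mmul N phi' P) (minv N phi')"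
  define X where "X = mmul N (mmul N K' (mmul N G (minv N K))) (mmul N (mmul N phi p) (minv N phi))"
  have "X = mmul N K' (mmul N P (mmul N G (mmul N p (smul (inverse c) (minv N phi)))))"
    unfolding X_def by (simp add: mmul_assoc phi_p mmul_smul_right cancel P3)
  also have "\<dots> = mmul N phi' (mmul N P (mmul N G (mmul N p (minv N phi))))"
    unfolding K'P using c(1) by (simp add: mmul_smul_right smul_smul)
  finally have X: "X = mmul N phi' (mmul N P (mmul N G (mmul N p (minv N phi))))" .
  \<comment> \<open>Each of \<open>X\<close> and \<open>?t\<close> is the other one times a matrix
    on the right, which gives both inclusions of ranges.\<close>
  have "X = mmul N ?t (mmul N phi' (mmul N G (mmul N p (minv N phi))))"
    by (simp add: X mmul_assoc cancel)
  moreover have "?t = mmul N X (mmul N phi (mmul N F (mmul N P (minv N phi'))))"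
    by (simp add: X mmul_assoc cancel P2 PP)
  ultimately have "mimage N X = mimage N ?t"
    using mimage_mmul_subset by (metis subset_antisym)
  then show ?thesis
    unfolding inv mimage_mmul X_def[symmetric] .
qed

theorem mainTheorem8:
  fixes m n j :: nat
    and q :: "real \<Rightarrow> real \<Rightarrow> cmat"
    and F :: "real \<Rightarrow> real \<Rightarrow> complex \<Rightarrow> cmat"
    and a1 a2 :: complex
    and p1 p2 :: cmat
    and pt1 pt2 :: "real \<Rightarrow> real \<Rightarrow> cmat"
  defines "N \<equiv> Nd m n"
  defines "phit \<equiv> (\<lambda>x t. smul (a1 - a2) (idm N) + smul (2 * a2) (pt2 x t) - smul (2 * a1) (pt1 x t))"
  defines "taut1 \<equiv> (\<lambda>x t. mmul N (mmul N (phit x t) (pt1 x t)) (minv N (phit x t)))"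
  defines "taut2 \<equiv> (\<lambda>x t. mmul N (mmul N (phit x t) (pt2 x t)) (minv N (phit x t)))"
  defines "q1 \<equiv> (\<lambda>x t. q x t + smul (2 * a1) (brk N (emat m n) (pt1 x t)))"
  defines "q2 \<equiv> (\<lambda>x t. q x t + smul (2 * a2) (brk N (emat m n) (pt2 x t)))"
  defines "q12 \<equiv> (\<lambda>x t. q1 x t + smul (2 * a2) (brk N (emat m n) (taut2 x t)))"
  defines "phi \<equiv> smul (a1 - a2) (idm N) + smul (2 * a2) p2 - smul (2 * a1) p1"
  defines "tau1 \<equiv> mmul N (mmul N phi p1) (minv N phi)"
  defines "tau2 \<equiv> mmul N (mmul N phi p2) (minv N phi)"
  defines "F1 \<equiv> dt_frame m n a1 p1 F pt1"
  defines "F2 \<equiv> dt_frame m n a2 p2 F pt2"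
  assumes "1 \<le> j"
    and "frame_sol m n j q F"
    and "\<forall>z. F 0 0 z = idm N"
    and "a1 \<noteq> 0" and "a2 \<noteq> 0" and "cmod a1 \<noteq> cmod a2"
    and "Oproj m n p1" and "Oproj m n p2"
    and "\<forall>x t. Oproj_onto m n (pt1 x t) (mvec N (minv N (F x t a1)) ` mimage N p1)"
    and "\<forall>x t. Oproj_onto m n (pt2 x t) (mvec N (minv N (F x t a2)) ` mimage N p2)"
    and "\<forall>x t. invertible_m N (phit x t)"
  shows "(\<forall>x t. q12 x t = q2 x t + smul (2 * a1) (brk N (emat m n) (taut1 x t)))
    \<and> flow_sol m n j q1 \<and> flow_sol m n j q2 \<and> flow_sol m n j q12
    \<and> darboux m n a1 tau1 q2 F2 q12
    \<and> darboux m n a2 tau2 q1 F1 q12"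
proof -
  have F: "frame_sol m n j q F" and F0: "\<And>z. F 0 0 z = idm N"
    and a: "a1 \<noteq> 0" "a2 \<noteq> 0" "cmod a1 \<noteq> cmod a2"
    and p: "Oproj m n p1" "Oproj m n p2"
    and pt1: "\<And>x t. Oproj_onto m n (pt1 x t) (mvec N (minv N (F x t a1)) ` mimage N p1)"
    and pt2: "\<And>x t. Oproj_onto m n (pt2 x t) (mvec N (minv N (F x t a2)) ` mimage N p2)"
    and inv: "\<And>x t. invertible_m N (phit x t)"
    using assms by blast+
  \<comment> \<open>Distinct moduli exclude \<open>a1 = a2\<close> and \<open>a1 = - a2\<close>, the
    values at which one simple factor is singular at the parameter of the other.\<close>
  have ne: "a1 \<noteq> a2" "a1 \<noteq> - a2" "a2 \<noteq> a1" "a2 \<noteq> - a1"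
    using a(3) by (auto simp: norm_minus_cancel)
  have O: "Oproj m n (pt1 x t)" "Oproj m n (pt2 x t)" for x t
    using pt1 pt2 by (auto simp: Oproj_onto_def)
  have P1: "wfm N (pt1 x t)" "mmul N (pt1 x t) (pt1 x t) = pt1 x t"
    and P2: "wfm N (pt2 x t)" "mmul N (pt2 x t) (pt2 x t) = pt2 x t" for x t
    using O[of x t] by (simp_all add: Oproj_def N_def)
  have Q1: "wfm N p1" "mmul N p1 p1 = p1" and Q2: "wfm N p2" "mmul N p2 p2 = p2"
    using p by (simp_all add: Oproj_def N_def)
  have phit: "phit x t = smul (a1 - a2) (idm N) + smul (2 * a2) (pt2 x t) - smul (2 * a1) (pt1 x t)"
    for x t by (simp add: phit_def)
  note psit = invertible_mD[OF inv]

  obtain S where S: "solution m n j q S"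
    and dG: "\<And>x t z. has_mderiv (\<lambda>y. adj m n (F y t (- z)))
        (- mmul N (conn_x m n q x t z) (adj m n (F x t (- z)))) x"
      "\<And>x t z. has_mderiv (\<lambda>s. adj m n (F x s (- z)))
        (- mmul N (conn_t m n j S x t z) (adj m n (F x t (- z)))) t"
    using frame_parallel[OF F] unfolding N_def by metis
  have mv1: "moved N a1 (conn_x m n q) (conn_t m n j S) pt1"
    using moved_frame[OF F dG[unfolded N_def] p(1) pt1[unfolded N_def]] by (simp add: N_def)
  have mv2: "moved N a2 (conn_x m n q) (conn_t m n j S) pt2"
    using moved_frame[OF F dG[unfolded N_def] p(2) pt2[unfolded N_def]] by (simp add: N_def)
  note d1 = moved_deriv[OF mv1 P1(2,1)] and d2 = moved_deriv[OF mv2 P2(2,1)]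
  have q1: "q1 x t = q x t + smul (2 * a1) (brk N (emat m n) (pt1 x t))"
    and q2: "q2 x t = q x t + smul (2 * a2) (brk N (emat m n) (pt2 x t))"
    and q12: "q12 x t = q1 x t + smul (2 * a2) (brk N (emat m n) (taut2 x t))" for x t
    by (simp_all add: q1_def q2_def q12_def)
  obtain S1 where S1: "solution m n j q1 S1"
    and g1: "\<And>x t. gauge N a1 (pt1 x t) (proj_vel N a1 (conn_x m n q x t) (pt1 x t))
        (conn_x m n q x t) (conn_x m n q1 x t)"
      "\<And>x t. gauge N a1 (pt1 x t) (proj_vel N a1 (conn_t m n j S x t) (pt1 x t))
        (conn_t m n j S x t) (conn_t m n j S1 x t)"
    using darboux_step[OF S O(1) d1[unfolded N_def] q1[unfolded N_def]] unfolding N_def by metis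
  obtain S2 where S2: "solution m n j q2 S2"
    using darboux_step[OF S O(2) d2[unfolded N_def] q2[unfolded N_def]] by metis

  \<comment> \<open>The second step starts here, without a frame for \<open>q1\<close>: the parallel
    matrices at \<open>a2\<close> and \<open>- a2\<close> are dressed instead.\<close>
  have "moved N a2 (conn_x m n q1) (conn_t m n j S1) taut2"
    unfolding taut2_def by (rule moved_step[OF mv2 P1 P2 d1 g1 phit inv])
  moreover have tO: "Oproj m n (taut1 x t)" "Oproj m n (taut2 x t)" for x t
    using Oproj_conj[OF O(1,2) phit[unfolded N_def] inv[unfolded N_def] a(1,2)]
    by (simp_all add: taut1_def taut2_def N_def)
  then have T2: "wfm N (taut2 x t)" "mmul N (taut2 x t) (taut2 x t) = taut2 x t" for x t
    by (simp_all add: Oproj_def N_def)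
  ultimately have d12: "has_mderiv (\<lambda>y. taut2 y t) (proj_vel N a2 (conn_x m n q1 x t) (taut2 x t)) x"
    "has_mderiv (\<lambda>s. taut2 x s) (proj_vel N a2 (conn_t m n j S1 x t) (taut2 x t)) t" for x t
    using moved_deriv by blast+
  obtain S12 where S12: "solution m n j q12 S12"
    using darboux_step[OF S1 tO(2) d12[unfolded N_def] q12[unfolded N_def]] by metis

  \<comment> \<open>Both sums of projections equal \<open>(a2^2 - a1^2) psi + (a1 + a2)\<close>,
    with \<open>psi\<close> the inverse of \<open>phit x t\<close>.\<close>
  have comm: "q12 x t = q2 x t + smul (2 * a1) (brk N (emat m n) (taut1 x t))" for x t
  proof -
    have "smul (2 * a1) (pt1 x t) + smul (2 * a2) (taut2 x t)
        = smul (2 * a2) (pt2 x t) + smul (2 * a1) (taut1 x t)"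
      unfolding taut1_def taut2_def
        conj_first[OF P1 P2 phit psit(2-4)] conj_second[OF P1 P2 phit psit(2-4)]
      by (simp add: fun_eq_iff)
    then have "brk N (emat m n) (smul (2 * a1) (pt1 x t) + smul (2 * a2) (taut2 x t))
        = brk N (emat m n) (smul (2 * a2) (pt2 x t) + smul (2 * a1) (taut1 x t))"
      by simp
    moreover have lin: "brk N A (smul c B + smul d C) = smul c (brk N A B) + smul d (brk N A C)"
      for A B C c d
      by (simp add: brk_def mmul_distribs)
    ultimately show ?thesis
      unfolding q12 q1 q2 lin by (simp only: add.assoc)
  qed

  \<comment> \<open>The normalization of the frame identifies the moving projections at the origin
    with \<open>p1\<close> and \<open>p2\<close>; so \<open>phi\<close> is \<open>phit 0 0\<close>
    and inherits its invertibility.\<close>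
  have "minv N (F 0 0 z) = idm N" for z
    unfolding F0 by (rule minv_eqI) simp_all
  then have "mvec N (minv N (F 0 0 z)) ` mimage N A = mimage N A" if "wfm N A" for z A
    using that by (simp add: mimage_mmul)
  then have "pt1 0 0 = p1" "pt2 0 0 = p2"
    using Oproj_onto_unique[OF p(1), of "pt1 0 0"] Oproj_onto_unique[OF p(2), of "pt2 0 0"]
      pt1[of 0 0] pt2[of 0 0] Q1(1) Q2(1) by (simp_all add: N_def)
  then have phi0: "phi = phit 0 0" by (simp add: phi_def phit_def)
  then have phi: "phi = smul (a1 - a2) (idm N) + smul (2 * a2) p2 - smul (2 * a1) p1"
    and invphi: "invertible_m N phi"
    using inv by (simp_all add: phi_def)
  note psi = invertible_mD[OF invphi]
  have tau: "Oproj m n tau1" "Oproj m n tau2"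
    using Oproj_conj[OF p phi[unfolded N_def] invphi[unfolded N_def] a(1,2)]
    by (simp_all add: tau1_def tau2_def N_def)

  note inF = frame_inverse[OF F, folded N_def]
  have pr1: "mmul N (pt1 x t) (mmul N (adj m n (F x t (- a1))) p1) = mmul N (adj m n (F x t (- a1))) p1"
    "mmul N p1 (mmul N (F x t a1) (pt1 x t)) = mmul N (F x t a1) (pt1 x t)"
    and pr2: "mmul N (pt2 x t) (mmul N (adj m n (F x t (- a2))) p2) = mmul N (adj m n (F x t (- a2))) p2"
    "mmul N p2 (mmul N (F x t a2) (pt2 x t)) = mmul N (F x t a2) (pt2 x t)" for x t
  proof -
    have *: "mmul N (F x t (- z)) (adj m n (F x t z)) = idm N"
      "mmul N (adj m n (F x t z)) (F x t (- z)) = idm N" for z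
      using inF(1,2)[of x t "- z"] by simp_all
    note proj = projection_onto_frame[OF inF(4,4)[unfolded N_def] inF(1,2)[unfolded N_def]
        *[unfolded N_def], folded N_def]
    show "mmul N (pt1 x t) (mmul N (adj m n (F x t (- a1))) p1) = mmul N (adj m n (F x t (- a1))) p1"
      "mmul N p1 (mmul N (F x t a1) (pt1 x t)) = mmul N (F x t a1) (pt1 x t)"
      using proj(1,2)[OF p(1) pt1[unfolded inF(3)]] by simp_all
    show "mmul N (pt2 x t) (mmul N (adj m n (F x t (- a2))) p2) = mmul N (adj m n (F x t (- a2))) p2"
      "mmul N p2 (mmul N (F x t a2) (pt2 x t)) = mmul N (F x t a2) (pt2 x t)"
      using proj(1,2)[OF p(2) pt2[unfolded inF(3)]] by simp_all
  qed

  have "Oproj_onto m n (taut1 x t) (mvec N (minv N (F2 x t a1)) ` mimage N tau1)" for x t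
  proof -
    have "mvec N (minv N (mmul N (mmul N (kmat m n a2 p2 a1) (F x t a1))
          (minv N (kmat m n a2 (pt2 x t) a1)))) ` mimage N (mmul N (mmul N phi p1) (minv N phi))
        = mimage N (mmul N (mmul N (phit x t) (pt1 x t)) (minv N (phit x t)))"
    proof (rule dressed_image[OF inF(1,2) P1(1) pr1(2,1) P1(2) _ _ invphi inv])
      show "invertible_m N (kmat m n a2 p2 a1)" "invertible_m N (kmat m n a2 (pt2 x t) a1)"
        using invertible_kmat[of m n _ a1 a2] Q2 P2 ne unfolding N_def by blast+
      \<comment> \<open>The scalar combines the factor \<open>1 / (a1 - a2)\<close> of
        \<open>kmat_Tmat\<close> with the sign in \<open>phi_on_first\<close>.\<close>
      show "- (1 / (a1 - a2)) \<noteq> 0" using ne by simp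
      show "mmul N (kmat m n a2 p2 a1) p1 = smul (- (1 / (a1 - a2))) (mmul N phi p1)"
        using phi_on_first(1)[OF Q1 Q2 phi psi(2-4)] unfolding kmat_Tmat[OF ne(1)] N_def
        by (simp add: mmul_smul_left) (simp add: smul_def fun_eq_iff)
      show "mmul N (kmat m n a2 (pt2 x t) a1) (pt1 x t)
          = smul (- (1 / (a1 - a2))) (mmul N (phit x t) (pt1 x t))"
        using phi_on_first(1)[OF P1 P2 phit psit(2-4)] unfolding kmat_Tmat[OF ne(1)] N_def
        by (simp add: mmul_smul_left) (simp add: smul_def fun_eq_iff)
    qed
    then show ?thesis
      using tO(1) by (simp add: Oproj_onto_def F2_def dt_frame_def tau1_def taut1_def N_def)
  qed
  then have D1: "darboux m n a1 tau1 q2 F2 q12"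
    unfolding darboux_def using a tau comm by (auto simp: N_def)

  have "Oproj_onto m n (taut2 x t) (mvec N (minv N (F1 x t a2)) ` mimage N tau2)" for x t
  proof -
    have "mvec N (minv N (mmul N (mmul N (kmat m n a1 p1 a2) (F x t a2))
          (minv N (kmat m n a1 (pt1 x t) a2)))) ` mimage N (mmul N (mmul N phi p2) (minv N phi))
        = mimage N (mmul N (mmul N (phit x t) (pt2 x t)) (minv N (phit x t)))"
    proof (rule dressed_image[OF inF(1,2) P2(1) pr2(2,1) P2(2) _ _ invphi inv])
      show "invertible_m N (kmat m n a1 p1 a2)" "invertible_m N (kmat m n a1 (pt1 x t) a2)"
        using invertible_kmat[of m n _ a2 a1] Q1 P1 ne unfolding N_def by blast+
      show "1 / (a2 - a1) \<noteq> 0" using ne by simp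
      show "mmul N (kmat m n a1 p1 a2) p2 = smul (1 / (a2 - a1)) (mmul N phi p2)"
        using phi_on_second(1)[OF Q1 Q2 phi psi(2-4)] unfolding kmat_Tmat[OF ne(3)] N_def
        by (simp add: mmul_smul_left)
      show "mmul N (kmat m n a1 (pt1 x t) a2) (pt2 x t)
          = smul (1 / (a2 - a1)) (mmul N (phit x t) (pt2 x t))"
        using phi_on_second(1)[OF P1 P2 phit psit(2-4)] unfolding kmat_Tmat[OF ne(3)] N_def
        by (simp add: mmul_smul_left)
    qed
    then show ?thesis
      using tO(2) by (simp add: Oproj_onto_def F1_def dt_frame_def tau2_def taut2_def N_def)
  qed
  then have D2: "darboux m n a2 tau2 q1 F1 q12"
    unfolding darboux_def using a tau q12 by (auto simp: N_def)

  have "flow_sol m n j q1" "flow_sol m n j q2" "flow_sol m n j q12"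
    using S1 S2 S12 unfolding solution_def flow_sol_def by blast+
  then show ?thesis using comm D1 D2 by blast
qed

end
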